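(* Assume the setting described in the context, and suppose that $(\rho,\sim)$ satisfies either the Algorithmic LLL condition with constant $\theta\in(0,1)$ or Shearer's condition with constant $\theta\in(0,1)$. Assume moreover that one of the following holds: (a) Algorithm 1 is run with a $\pi$-stable strategy, for some permutation $\pi$ of $F$; (b) $(\rho,\sim)$ is weakly commutative and $\rho$ is atomic; (c) $(\rho,\sim)$ is strongly commutative. Let $\omega^{\mathrm{init}}$ be an arbitrary initial distribution on $\Omega$; in cases (b) and (c) the flaw selection strategy is arbitrary. Define $$\gamma^{\mathrm{init}}=\max_{\sigma\in\Omega}\frac{\omega^{\mathrm{init}}(\sigma)}{\omega(\sigma)}.$$ In cases (a) and (b) let $\mathcal{I}^{\mathrm{init}}=\bigcup_{\sigma\in\mathrm{supp}(\omega^{\mathrm{init}})}\mathrm{Ind}(F_\sigma)$, where $\mathrm{supp}(\omega^{\mathrm{init}})=\{\sigma:\omega^{\mathrm{init}}(\sigma)>0\}$. In case (c) let $\mathcal{I}^{\mathrm{init}}=\mathrm{Ind}(F)$. Let $$T=\frac{1}{\log\theta^{-1}}\Big(\log\gamma^{\mathrm{init}}+\log\sum_{R\in\mathcal{I}^{\mathrm{init}}}\mu(R)\Big).$$ Here $\mu(R)=\prod_{f\in R}\mu_f$ in the case of the Algorithmic LLL condition, and $\mu(R)=q_R(p)/q_\varnothing(p)$ in the case of Shearer's condition. Then for every $r$, the probability that Algorithm 1 produces a flawless object in fewer than $T+r$ steps is at least $1-\theta^r$.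
   Context: Setting: $\Omega$ is a finite set of objects and $F$ is a finite set of flaws, each flaw $f\in F$ being a nonempty subset of $\Omega$. For $\sigma\in\Omega$ let $F_\sigma=\{f\in F:\sigma\in f\}$; $\sigma$ is flawless if $F_\sigma=\varnothing$. For every $\sigma\in\Omega$ and $f\in F_\sigma$ a probability distribution $\rho(\cdot\mid f,\sigma)$ on $\Omega$ is given; its (nonempty) support is denoted $A(f,\sigma)$, and the collection of these distributions is denoted $\rho$. A fixed probability distribution $\omega$ on $\Omega$ satisfies $\omega(\sigma)>0$ for all $\sigma$. We write $\sigma\xrightarrow{f}\sigma'$ (a valid step) when $f\in F_\sigma$ and $\sigma'\in A(f,\sigma)$. A walk is a sequence $\sigma_1\xrightarrow{w_1}\sigma_2\cdots\xrightarrow{w_t}\sigma_{t+1}$ of valid steps. A symmetric relation $\sim$ on $F$ is fixed; loops $f\sim f$ are allowed. Write $\Gamma(f)=\{g:f\sim g\}$ and $\Gamma^+(f)=\Gamma(f)\cup\{f\}$, and for $S\subseteq F$ write $\Gamma(S)=\bigcup_{f\in S}\Gamma(f)$ and $\Gamma^+(S)=\bigcup_{f\in S}\Gamma^+(f)$. It is assumed that $(F,\sim)$ is a potential causality graph for $\rho$: for every valid step $\sigma\xrightarrow{f}\sigma'$ we have $F_{\sigma'}\subseteq(F_\sigma\setminus\{f\})\cup\Gamma(f)$. A set $S\subseteq F$ is independent if $f\not\sim g$ for all distinct $f,g\in S$; $\mathrm{Ind}(S)$ denotes the family of independent subsets of $S$. $\rho$ is atomic if for every $f\in F$ and $\sigma'\in\Omega$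 there is at most one $\sigma$ with $\sigma\xrightarrow{f}\sigma'$. $(\rho,\sim)$ is weakly commutative if there is an injective map SWAP sending every walk $\sigma_1\xrightarrow{f}\sigma_2\xrightarrow{g}\sigma_3$ with $f\not\sim g$ to a walk $\sigma_1\xrightarrow{g}\sigma_2'\xrightarrow{f}\sigma_3$. It is strongly commutative if, in addition, for every such walk with image $\sigma_1\xrightarrow{g}\sigma_2'\xrightarrow{f}\sigma_3$, $$\rho(\sigma_2\mid f,\sigma_1)\,\rho(\sigma_3\mid g,\sigma_2)=\rho(\sigma_2'\mid g,\sigma_1)\,\rho(\sigma_3\mid f,\sigma_2').$$ Algorithmic LLL condition (with constant $\theta\in(0,1)$): there exist vectors $\lambda,\mu\in\mathbb{R}^F$ with $\mu_f\neq0$ such that (i) $\lambda_f\ge\sum_{\sigma\in f:\,\sigma'\in A(f,\sigma)}\rho(\sigma'\mid f,\sigma)\,\omega(\sigma)/\omega(\sigma')$ for all $f\in F$ and $\sigma'\in\Omega$; (ii) $\frac{\lambda_f}{\mu_f}\sum_{S\in\mathrm{Ind}(\Gamma(f))}\mu(S)\le\theta$ for all $f$, where $\mu(S)=\prod_{g\in S}\mu_g$. Shearer's condition: for $p\in\mathbb{R}^F$ and $S\subseteq F$ let $p^S=\prod_{f\in S}p_f$ and $q_S(p)=\sum_{I:\,S\subseteq I\in\mathrm{Ind}(F)}(-1)^{|I|-|S|}p^I$. The vector $p$ satisfies Shearer's condition if $q_S(p)\ge0$ for all $S\subseteq F$ and $q_\varnothing(p)>0$. The pair $(\rho,\sim)$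 satisfies Shearer's condition with constant $\theta\in(0,1)$ if there exist such a $p$ and a vector $\lambda$ satisfying (i) with $\lambda_f\le\theta p_f$ for all $f$. Algorithm 1 (input: initial distribution $\omega^{\mathrm{init}}$ on $\Omega$ and a strategy). Sample $\sigma$ from $\omega^{\mathrm{init}}$. While $F_\sigma\neq\varnothing$: select $f\in F_\sigma$ according to the strategy, sample $\sigma'$ from $\rho(\cdot\mid f,\sigma)$, and set $\sigma\leftarrow\sigma'$. Each iteration is a step. A strategy may choose $f$ as any (possibly randomized) function of the entire past execution history. Algorithm 2. Sample $\sigma$ from $\omega^{\mathrm{init}}$. While $F_\sigma\neq\varnothing$ do a round: set $I=\varnothing$; while $F_\sigma\setminus\Gamma^+(I)\ne\varnothing$, pick some $f\in F_\sigma\setminus\Gamma^+(I)$, sample $\sigma'$ from $\rho(\cdot\mid f,\sigma)$, set $\sigma\leftarrow\sigma'$ and $I\leftarrow I\cup\{f\}$. For a permutation $\pi$ of $F$, with induced total order $\preceq_\pi$, the $\pi$-stable strategy is the strategy for Algorithm 1 given by running Algorithm 2 and always picking the $\preceq_\pi$-lowest flaw of $F_\sigma\setminus\Gamma^+(I)$.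
   Formalization: In the Algorithmic LLL condition the vector μ is assumed strictly positive (μ_f > 0) rather than merely μ_f ≠ 0; with negative entries condition (ii) can hold vacuously and the claimed bound is false. *)

theory Defs
  imports "HOL-Probability.Probability"
begin

text \<open>Objects: the elements of a finite type 'a (Omega = UNIV).
  Flaws: nonempty subsets of Omega; F :: 'a set set.
  rho f sigma : the distribution rho(. | f, sigma); its support is set_pmf (rho f sigma).
  A history of an execution of Algorithm 1 is (sigma_1, [(w_1,sigma_2), ..., (w_t,sigma_{t+1})]).\<close>

type_synonym 'a hist = "'a \<times> ('a set \<times> 'a) list"

definition cur :: "'a hist \<Rightarrow> 'a" where
  "cur h = (if snd h = [] then fst h else snd (last (snd h)))"

definition flaws_at :: "'a set set \<Rightarrow> 'a \<Rightarrow> 'a set set" where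
  "flaws_at F \<sigma> = {f \<in> F. \<sigma> \<in> f}"

definition Gam :: "'a set set \<Rightarrow> ('a set \<Rightarrow> 'a set \<Rightarrow> bool) \<Rightarrow> 'a set \<Rightarrow> 'a set set" where
  "Gam F sim f = {g \<in> F. sim f g}"

definition GamP_set :: "'a set set \<Rightarrow> ('a set \<Rightarrow> 'a set \<Rightarrow> bool) \<Rightarrow> 'a set set \<Rightarrow> 'a set set" where
  "GamP_set F sim S = (\<Union>f\<in>S. insert f (Gam F sim f))"

definition Ind :: "('a set \<Rightarrow> 'a set \<Rightarrow> bool) \<Rightarrow> 'a set set \<Rightarrow> 'a set set set" where
  "Ind sim S = {I. I \<subseteq> S \<and> (\<forall>f\<in>I. \<forall>g\<in>I. f \<noteq> g \<longrightarrow> \<not> sim f g)}"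

definition valid_step :: "'a set set \<Rightarrow> ('a set \<Rightarrow> 'a \<Rightarrow> 'a pmf) \<Rightarrow> 'a \<Rightarrow> 'a set \<Rightarrow> 'a \<Rightarrow> bool" where
  "valid_step F rho \<sigma> f \<sigma>' \<longleftrightarrow> f \<in> flaws_at F \<sigma> \<and> \<sigma>' \<in> set_pmf (rho f \<sigma>)"

definition flaw_setting ::
  "'a set set \<Rightarrow> ('a set \<Rightarrow> 'a set \<Rightarrow> bool) \<Rightarrow> ('a set \<Rightarrow> 'a \<Rightarrow> 'a pmf) \<Rightarrow> 'a pmf \<Rightarrow> bool" where
  "flaw_setting F sim rho \<omega> \<longleftrightarrow>
     (\<forall>f\<in>F. f \<noteq> {}) \<and>
     (\<forall>\<sigma>. pmf \<omega> \<sigma> > 0) \<and>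
     (\<forall>f\<in>F. \<forall>g\<in>F. sim f g \<longleftrightarrow> sim g f) \<and>
     (\<forall>\<sigma> f \<sigma>'. valid_step F rho \<sigma> f \<sigma>' \<longrightarrow>
        flaws_at F \<sigma>' \<subseteq> (flaws_at F \<sigma> - {f}) \<union> Gam F sim f)"

definition atomic :: "'a set set \<Rightarrow> ('a set \<Rightarrow> 'a \<Rightarrow> 'a pmf) \<Rightarrow> bool" where
  "atomic F rho \<longleftrightarrow> (\<forall>f\<in>F. \<forall>\<sigma>'. \<forall>\<sigma>1 \<sigma>2.
      valid_step F rho \<sigma>1 f \<sigma>' \<and> valid_step F rho \<sigma>2 f \<sigma>' \<longrightarrow> \<sigma>1 = \<sigma>2)"

definition swap_dom :: "'a set set \<Rightarrow> ('a set \<Rightarrow> 'a set \<Rightarrow> bool) \<Rightarrow> ('a set \<Rightarrow> 'a \<Rightarrow> 'a pmf)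
    \<Rightarrow> ('a \<times> 'a set \<times> 'a \<times> 'a set \<times> 'a) set" where
  "swap_dom F sim rho = {(\<sigma>1, f, \<sigma>2, g, \<sigma>3). valid_step F rho \<sigma>1 f \<sigma>2 \<and> valid_step F rho \<sigma>2 g \<sigma>3 \<and> \<not> sim f g}"

definition is_swap :: "'a set set \<Rightarrow> ('a set \<Rightarrow> 'a set \<Rightarrow> bool) \<Rightarrow> ('a set \<Rightarrow> 'a \<Rightarrow> 'a pmf)
    \<Rightarrow> (('a \<times> 'a set \<times> 'a \<times> 'a set \<times> 'a) \<Rightarrow> ('a \<times> 'a set \<times> 'a \<times> 'a set \<times> 'a)) \<Rightarrow> bool" where
  "is_swap F sim rho SW \<longleftrightarrow> inj_on SW (swap_dom F sim rho) \<and>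
     (\<forall>\<sigma>1 f \<sigma>2 g \<sigma>3. (\<sigma>1, f, \<sigma>2, g, \<sigma>3) \<in> swap_dom F sim rho \<longrightarrow>
        (\<exists>\<sigma>2'. SW (\<sigma>1, f, \<sigma>2, g, \<sigma>3) = (\<sigma>1, g, \<sigma>2', f, \<sigma>3) \<and>
               valid_step F rho \<sigma>1 g \<sigma>2' \<and> valid_step F rho \<sigma>2' f \<sigma>3))"

definition weakly_commutative :: "'a set set \<Rightarrow> ('a set \<Rightarrow> 'a set \<Rightarrow> bool) \<Rightarrow> ('a set \<Rightarrow> 'a \<Rightarrow> 'a pmf) \<Rightarrow> bool" where
  "weakly_commutative F sim rho \<longleftrightarrow> (\<exists>SW. is_swap F sim rho SW)"

definition strongly_commutative :: "'a set set \<Rightarrow> ('a set \<Rightarrow> 'a set \<Rightarrow> bool) \<Rightarrow> ('a set \<Rightarrow> 'a \<Rightarrow> 'a pmf) \<Rightarrow> bool" where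
  "strongly_commutative F sim rho \<longleftrightarrow> (\<exists>SW. is_swap F sim rho SW \<and>
     (\<forall>\<sigma>1 f \<sigma>2 g \<sigma>3 \<sigma>2'. (\<sigma>1, f, \<sigma>2, g, \<sigma>3) \<in> swap_dom F sim rho \<longrightarrow>
        SW (\<sigma>1, f, \<sigma>2, g, \<sigma>3) = (\<sigma>1, g, \<sigma>2', f, \<sigma>3) \<longrightarrow>
        pmf (rho f \<sigma>1) \<sigma>2 * pmf (rho g \<sigma>2) \<sigma>3 = pmf (rho g \<sigma>1) \<sigma>2' * pmf (rho f \<sigma>2') \<sigma>3))"

definition lambda_ok :: "'a set set \<Rightarrow> ('a set \<Rightarrow> 'a \<Rightarrow> 'a pmf) \<Rightarrow> 'a pmf \<Rightarrow> ('a set \<Rightarrow> real) \<Rightarrow> bool" where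
  "lambda_ok F rho \<omega> lam \<longleftrightarrow> (\<forall>f\<in>F. \<forall>\<sigma>'.
     lam f \<ge> (\<Sum>\<sigma>\<in>{\<sigma>\<in>f. \<sigma>' \<in> set_pmf (rho f \<sigma>)}. pmf (rho f \<sigma>) \<sigma>' * pmf \<omega> \<sigma> / pmf \<omega> \<sigma>'))"

definition alg_LLL :: "'a set set \<Rightarrow> ('a set \<Rightarrow> 'a set \<Rightarrow> bool) \<Rightarrow> ('a set \<Rightarrow> 'a \<Rightarrow> 'a pmf) \<Rightarrow> 'a pmf
    \<Rightarrow> real \<Rightarrow> ('a set \<Rightarrow> real) \<Rightarrow> ('a set \<Rightarrow> real) \<Rightarrow> bool" where
  "alg_LLL F sim rho \<omega> \<theta> lam mu \<longleftrightarrow>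
     (\<forall>f\<in>F. mu f > 0) \<and> lambda_ok F rho \<omega> lam \<and>
     (\<forall>f\<in>F. lam f / mu f * (\<Sum>S\<in>Ind sim (Gam F sim f). \<Prod>g\<in>S. mu g) \<le> \<theta>)"

definition qS :: "'a set set \<Rightarrow> ('a set \<Rightarrow> 'a set \<Rightarrow> bool) \<Rightarrow> ('a set \<Rightarrow> real) \<Rightarrow> 'a set set \<Rightarrow> real" where
  "qS F sim p S = (\<Sum>I\<in>{I\<in>Ind sim F. S \<subseteq> I}. (-1) ^ (card I - card S) * (\<Prod>f\<in>I. p f))"

definition shearer_vec :: "'a set set \<Rightarrow> ('a set \<Rightarrow> 'a set \<Rightarrow> bool) \<Rightarrow> ('a set \<Rightarrow> real) \<Rightarrow> bool" where
  "shearer_vec F sim p \<longleftrightarrow> (\<forall>S. S \<subseteq> F \<longrightarrow> qS F sim p S \<ge> 0) \<and> qS F sim p {} > 0"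

definition shearer :: "'a set set \<Rightarrow> ('a set \<Rightarrow> 'a set \<Rightarrow> bool) \<Rightarrow> ('a set \<Rightarrow> 'a \<Rightarrow> 'a pmf) \<Rightarrow> 'a pmf
    \<Rightarrow> real \<Rightarrow> ('a set \<Rightarrow> real) \<Rightarrow> ('a set \<Rightarrow> real) \<Rightarrow> bool" where
  "shearer F sim rho \<omega> \<theta> lam p \<longleftrightarrow>
     shearer_vec F sim p \<and> lambda_ok F rho \<omega> lam \<and> (\<forall>f\<in>F. lam f \<le> \<theta> * p f)"

definition valid_strategy :: "'a set set \<Rightarrow> ('a hist \<Rightarrow> 'a set pmf) \<Rightarrow> bool" where
  "valid_strategy F S \<longleftrightarrow> (\<forall>h. flaws_at F (cur h) \<noteq> {} \<longrightarrow> set_pmf (S h) \<subseteq> flaws_at F (cur h))"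

primrec run :: "'a set set \<Rightarrow> ('a set \<Rightarrow> 'a \<Rightarrow> 'a pmf) \<Rightarrow> 'a pmf \<Rightarrow> ('a hist \<Rightarrow> 'a set pmf)
    \<Rightarrow> nat \<Rightarrow> 'a hist pmf" where
  "run F rho w0 S 0 = map_pmf (\<lambda>\<sigma>. (\<sigma>, [])) w0"
| "run F rho w0 S (Suc n) = bind_pmf (run F rho w0 S n) (\<lambda>h.
     if flaws_at F (cur h) = {} then return_pmf h
     else bind_pmf (S h) (\<lambda>f. map_pmf (\<lambda>\<sigma>'. (fst h, snd h @ [(f, \<sigma>')])) (rho f (cur h))))"

text \<open>pi-stable strategy: replay Algorithm 2 along the history to recover the current set I.\<close>
fun stable_I :: "'a set set \<Rightarrow> ('a set \<Rightarrow> 'a set \<Rightarrow> bool) \<Rightarrow> 'a \<Rightarrow> 'a set set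
    \<Rightarrow> ('a set \<times> 'a) list \<Rightarrow> 'a set set" where
  "stable_I F sim \<sigma> I [] = I"
| "stable_I F sim \<sigma> I ((f, \<sigma>') # xs) =
     stable_I F sim \<sigma>' (if flaws_at F \<sigma> - GamP_set F sim I = {} then {f} else insert f I) xs"

definition stable_strategy :: "'a set set \<Rightarrow> ('a set \<Rightarrow> 'a set \<Rightarrow> bool) \<Rightarrow> ('a set \<Rightarrow> nat)
    \<Rightarrow> 'a hist \<Rightarrow> 'a set pmf" where
  "stable_strategy F sim \<pi> h =
     (let \<sigma> = cur h; I = stable_I F sim (fst h) {} (snd h);
          C = flaws_at F \<sigma> - GamP_set F sim I
      in return_pmf (if C \<noteq> {} then arg_min_on \<pi> C else arg_min_on \<pi> (flaws_at F \<sigma>)))"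

definition gamma_init :: "'a::finite pmf \<Rightarrow> 'a pmf \<Rightarrow> real" where
  "gamma_init \<omega> w0 = Max (range (\<lambda>\<sigma>. pmf w0 \<sigma> / pmf \<omega> \<sigma>))"

end

theory Submission
  imports Defs
begin

text \<open>Words of flaws are considered up to swapping adjacent letters \<open>f \<noteq> g\<close> with \<open>f \<nsim> g\<close>
  (trace equivalence). Each trace is represented by a layered word: a sequence of independent
  blocks, each contained in the neighbourhood \<open>\<Gamma>\<^sup>+\<close> of its predecessor, and in \<open>\<Gamma>\<close> of its
  predecessor if a walk with this word exists. Either local lemma condition bounds the total
  weight \<open>\<Prod> \<lambda>\<^sub>f\<close> of the layered words of length \<open>t\<close> with first block \<open>R\<close> by \<open>\<theta>\<^sup>t \<mu>(R)\<close>.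

  The \<open>\<pi>\<close>-stable strategy only produces layered words. For the other two cases, replace the step
  matrices \<open>\<rho>\<^sub>f\<close> by dominating nonnegative matrices \<open>K\<^sub>f\<close> with \<open>\<omega> K\<^sub>f \<le> \<lambda>\<^sub>f \<omega>\<close> such that
  \<open>K\<^sub>f K\<^sub>g = K\<^sub>g K\<^sub>f\<close> for \<open>f \<nsim> g\<close>: in the strongly commutative case take \<open>\<rho>\<^sub>f\<close> itself, since SWAP
  is a weight preserving injection in both directions; in the weakly commutative atomic case take
  \<open>\<lambda>\<^sub>f \<omega>(\<sigma>') / \<omega>(\<sigma>)\<close> on valid steps. Then \<open>K\<^sub>w 1\<close> depends only on the trace of \<open>w\<close>, and by left
  cancellation of traces the sum of \<open>(K\<^sub>w 1)(\<sigma>)\<close> over all traces of the remaining length is a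
  supermartingale under every strategy.\<close>

subsection \<open>Trace equivalence and layered words\<close>

inductive teq :: "('b \<Rightarrow> 'b \<Rightarrow> bool) \<Rightarrow> 'b list \<Rightarrow> 'b list \<Rightarrow> bool" for C where
  teq_refl: "teq C xs xs"
| teq_swap: "C a b \<Longrightarrow> teq C (a # b # xs) (b # a # xs)"
| teq_Cons: "teq C xs ys \<Longrightarrow> teq C (a # xs) (a # ys)"
| teq_trans: "teq C xs ys \<Longrightarrow> teq C ys zs \<Longrightarrow> teq C xs zs"

declare teq_trans [trans]

lemma teq_sym: "teq C xs ys \<Longrightarrow> symp C \<Longrightarrow> teq C ys xs"
proof (induction rule: teq.induct)
  case (teq_trans xs ys zs)
  then show ?case by (blast intro: teq.teq_trans)
qed (auto intro: teq.intros(1-3) dest: sympD)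

lemma teq_mset: "teq C xs ys \<Longrightarrow> mset xs = mset ys"
  by (induction rule: teq.induct) auto

lemma teq_set: "teq C xs ys \<Longrightarrow> set xs = set ys"
  by (metis mset_eq_setD teq_mset)

lemma teq_length: "teq C xs ys \<Longrightarrow> length xs = length ys"
  by (metis mset_eq_length teq_mset)

text \<open>Left cancellation of traces rests on this: a swap either survives the deletion of
  \<open>x\<close>, or one letter of the exchanged pair is deleted and both sides become
  equal.\<close>

lemma teq_remove1: "teq C xs ys \<Longrightarrow> teq C (remove1 x xs) (remove1 x ys)"
proof (induction rule: teq.induct)
  case (teq_trans xs ys zs)
  then show ?case by (blast intro: teq.teq_trans)
qed (auto intro: teq.intros(1-3))

lemma teq_Cons_cancel: "teq C (x # xs) (x # ys) \<Longrightarrow> teq C xs ys"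
  using teq_remove1[of C "x # xs" "x # ys" x] by simp

lemma teq_append_left: "teq C xs ys \<Longrightarrow> teq C (zs @ xs) (zs @ ys)"
  by (induction zs) (auto intro: teq_Cons)

lemma teq_append_right: "teq C xs ys \<Longrightarrow> teq C (xs @ zs) (ys @ zs)"
proof (induction rule: teq.induct)
  case (teq_trans xs ys zs)
  then show ?case by (blast intro: teq.teq_trans)
qed (auto intro: teq.intros(1-3))

lemma teq_move:
  assumes "\<And>y. y \<in> set ys \<Longrightarrow> C x y"
  shows "teq C (x # ys) (ys @ [x])"
  using assms
proof (induction ys)
  case (Cons y ys)
  have "teq C (x # y # ys) (y # x # ys)"
    using Cons.prems by (auto intro: teq_swap)
  also have "teq C (y # x # ys) (y # ys @ [x])"
    using Cons by (auto intro: teq_Cons)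
  finally show ?case by simp
qed (simp add: teq_refl)

text \<open>Letters of an independent block commute pairwise, so up to \<open>teq\<close> a block
  may be treated as a set and spelled in any order.\<close>

lemma teq_permute:
  assumes "symp C" "mset xs = mset ys" "distinct xs"
    and "\<And>x y. x \<in> set xs \<Longrightarrow> y \<in> set xs \<Longrightarrow> x \<noteq> y \<Longrightarrow> C x y"
  shows "teq C xs ys"
  using assms(2-)
proof (induction xs arbitrary: ys)
  case (Cons x xs)
  have "x \<in> set ys"
    using Cons.prems(1) by (metis list.set_intros(1) mset_eq_setD)
  then obtain us vs where ys: "ys = us @ x # vs"
    by (auto dest: split_list)
  have m: "mset xs = mset (us @ vs)"
    using Cons.prems(1) ys by simp
  have s: "set us \<subseteq> set xs"
    using mset_eq_setD[OF m] by auto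
  have "teq C (x # xs) (x # us @ vs)"
    using Cons.IH[OF m] Cons.prems(2,3) by (auto intro: teq_Cons)
  also have "teq C (x # us @ vs) ((us @ [x]) @ vs)"
    using teq_append_right[OF teq_move[of us C x], of vs] Cons.prems(2,3) s by force
  finally show ?case by (simp add: ys)
qed (simp add: teq_refl)

section \<open>Layered normal forms of traces\<close>

definition Gams :: "'a set set \<Rightarrow> ('a set \<Rightarrow> 'a set \<Rightarrow> bool) \<Rightarrow> 'a set set \<Rightarrow> 'a set set" where
  "Gams F sim R = (\<Union>f\<in>R. Gam F sim f)"

lemma GamP_set_eq: "GamP_set F sim R = R \<union> Gams F sim R"
  by (auto simp: GamP_set_def Gams_def)

text \<open>The value \<open>{}\<close> on the empty sequence makes the containment demanded after
  the last block vacuous and files the empty word under \<open>R = {}\<close>.\<close>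

fun first_block :: "'b set list \<Rightarrow> 'b set" where
  "first_block [] = {}"
| "first_block (B # Bs) = B"

text \<open>\<open>\<pi>\<close> fixes the order in which a block is spelled out. For a stable
  strategy it is the permutation of that strategy, otherwise an arbitrary injection.\<close>

locale flaw_order =
  fixes F :: "'a::finite set set" and sim :: "'a set \<Rightarrow> 'a set \<Rightarrow> bool" and \<pi> :: "'a set \<Rightarrow> nat"
  assumes sim_sym: "f \<in> F \<Longrightarrow> g \<in> F \<Longrightarrow> sim f g \<longleftrightarrow> sim g f"
    and inj_pi: "inj_on \<pi> F"
begin

definition comm :: "'a set \<Rightarrow> 'a set \<Rightarrow> bool" where
  "comm f g \<longleftrightarrow> f \<in> F \<and> g \<in> F \<and> f \<noteq> g \<and> \<not> sim f g"

lemma symp_comm: "symp comm"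
  by (auto simp: comm_def symp_def sim_sym)

definition ordered :: "'a set set \<Rightarrow> 'a set list" where
  "ordered B = map (inv_into F \<pi>) (sorted_list_of_set (\<pi> ` B))"

definition word :: "'a set set list \<Rightarrow> 'a set list" where
  "word Bs = concat (map ordered Bs)"

lemma word_simps [simp]: "word [] = []" "word (B # Bs) = ordered B @ word Bs"
  "word (Bs @ Bs') = word Bs @ word Bs'"
  by (auto simp: word_def)

lemma ordered_empty [simp]: "ordered {} = []"
  by (simp add: ordered_def)

lemma set_ordered: "B \<subseteq> F \<Longrightarrow> set (ordered B) = B"
  using inj_pi by (force simp: ordered_def image_image subset_iff)

lemma distinct_ordered: "B \<subseteq> F \<Longrightarrow> distinct (ordered B)"
  unfolding ordered_def distinct_map
  by (auto intro: inj_on_inv_into)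

lemma length_ordered: "B \<subseteq> F \<Longrightarrow> length (ordered B) = card B"
  using distinct_card[OF distinct_ordered] set_ordered by metis

text \<open>This matches a step of a stable strategy, which addresses the flaws of one round in
  increasing \<open>\<pi>\<close> order.\<close>

lemma ordered_insert:
  assumes "B \<subseteq> F" "f \<in> F" "\<And>g. g \<in> B \<Longrightarrow> \<pi> g < \<pi> f"
  shows "ordered (insert f B) = ordered B @ [f]"
proof -
  have "\<pi> f \<notin> \<pi> ` B" using assms(3) by force
  moreover have "\<forall>x\<in>set (sorted_list_of_set (\<pi> ` B)). x \<le> \<pi> f"
    using assms(3) by (auto intro: less_imp_le)
  ultimately show ?thesis
    using inj_pi assms(2) by (simp add: ordered_def sorted_insort_is_snoc)
qed

text \<open>With \<open>N = GamP_set F sim\<close> this is the Cartier-Foata normal form of a trace;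
  \<open>N = Gams F sim\<close> is the stronger form that holds for words of walks.\<close>

primrec layered :: "('a set set \<Rightarrow> 'a set set) \<Rightarrow> 'a set set list \<Rightarrow> bool" where
  "layered N [] \<longleftrightarrow> True"
| "layered N (B # Bs) \<longleftrightarrow> B \<noteq> {} \<and> B \<in> Ind sim F \<and> first_block Bs \<subseteq> N B \<and> layered N Bs"

lemma layered_append:
  "layered N (Bs @ [B]) \<longleftrightarrow> layered N Bs \<and> B \<noteq> {} \<and> B \<in> Ind sim F \<and> (Bs \<noteq> [] \<longrightarrow> B \<subseteq> N (last Bs))"
proof (induction Bs)
  case (Cons A Bs)
  then show ?case by (cases Bs) auto
qed auto

lemma Ind_subset: "B \<in> Ind sim A \<Longrightarrow> B \<subseteq> A"
  by (auto simp: Ind_def)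

lemma Ind_mono: "A \<subseteq> A' \<Longrightarrow> Ind sim A \<subseteq> Ind sim A'"
  by (auto simp: Ind_def)

lemma first_block_Ind: "layered N Bs \<Longrightarrow> first_block Bs \<in> Ind sim F"
  by (cases Bs) (auto simp: Ind_def)

lemma set_word: "layered N Bs \<Longrightarrow> set (word Bs) \<subseteq> F"
proof (induction Bs)
  case (Cons B Bs)
  then show ?case using set_ordered[of B] Ind_subset[of B F] by simp
qed simp

abbreviation GP where "GP \<equiv> GamP_set F sim"

text \<open>Appending a letter puts it into the block behind the last block it depends on.\<close>

lemma layered_snoc:
  assumes "layered GP Bs" "x \<in> F"
  shows "\<exists>Bs'. layered GP Bs' \<and> teq comm (word Bs @ [x]) (word Bs') \<and>
    first_block Bs' = (if \<forall>y\<in>set (word Bs). comm x y then insert x (first_block Bs) else first_block Bs)"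
  using assms
proof (induction Bs)
  case Nil
  have "ordered {x} = [x]" using ordered_insert[of "{}" x] Nil by simp
  then show ?case using Nil by (intro exI[of _ "[{x}]"]) (auto simp: Ind_def teq_refl)
next
  case (Cons B Bs)
  then obtain Bs' where Bs': "layered GP Bs'" "teq comm (word Bs @ [x]) (word Bs')"
    "first_block Bs' = (if \<forall>y\<in>set (word Bs). comm x y then insert x (first_block Bs) else first_block Bs)"
    by auto
  have B: "B \<subseteq> F" "B \<in> Ind sim F" using Cons.prems by (auto dest: Ind_subset)
  show ?case
  \<comment> \<open>A letter that commutes with everything moves to the front and joins
    \<open>B\<close>. Otherwise it is absorbed further back and \<open>B\<close> stays.\<close>
  proof (cases "\<forall>y\<in>set (word (B # Bs)). comm x y")
    case True
    then have cB: "\<And>y. y \<in> B \<Longrightarrow> comm x y" and cBs: "\<And>y. y \<in> set (word Bs) \<Longrightarrow> comm x y"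
      using set_ordered[OF B(1)] by auto
    have xB: "x \<notin> B" using cB by (auto simp: comm_def)
    have I: "insert x B \<in> Ind sim F"
      proof -
      have "\<not> sim x y" "\<not> sim y x" if "y \<in> B" for y
        using cB[OF that] sim_sym by (auto simp: comm_def)
      then show ?thesis using B Cons.prems(2) by (auto simp: Ind_def)
    qed
    have "teq comm (word Bs @ [x]) (x # word Bs)"
      using teq_move[of "word Bs" comm x] cBs by (blast intro: teq_sym symp_comm)
    then have "teq comm (ordered B @ word Bs @ [x]) (ordered B @ x # word Bs)"
      by (rule teq_append_left)
    also have "teq comm (ordered B @ x # word Bs) (ordered (insert x B) @ word Bs)"
    proof -
      have iF: "insert x B \<subseteq> F" using B Cons.prems by simp
      have "teq comm (ordered B @ [x]) (ordered (insert x B))"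
      proof (rule teq_permute[OF symp_comm])
        show "distinct (ordered B @ [x])"
          using distinct_ordered[OF B(1)] set_ordered[OF B(1)] xB by simp
        then show "mset (ordered B @ [x]) = mset (ordered (insert x B))"
          using set_ordered[OF B(1)] set_ordered[OF iF] distinct_ordered[OF iF]
          by (subst set_eq_iff_mset_eq_distinct[symmetric]) auto
        show "comm u v" if "u \<in> set (ordered B @ [x])" "v \<in> set (ordered B @ [x])" "u \<noteq> v" for u v
          using that I iF set_ordered[OF B(1)] by (auto simp: comm_def Ind_def)
      qed
      from teq_append_right[OF this, of "word Bs"] show ?thesis by simp
    qed
    finally show ?thesis
      using True I Cons.prems
      by (intro exI[of _ "insert x B # Bs"]) (auto simp: GamP_set_def)
  next
    case False
    have "first_block Bs' \<subseteq> GP B"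
    \<comment> \<open>Only a letter commuting with all of \<open>word Bs\<close> enters the block
      right behind \<open>B\<close>; it then depends on some letter of \<open>B\<close>, hence lies
      in \<open>GP B\<close>.\<close>
    proof (cases "\<forall>y\<in>set (word Bs). comm x y")
      case True
      with False obtain y where "y \<in> B" "\<not> comm x y" using set_ordered[OF B(1)] by auto
      then have "x \<in> GP B"
        using B Cons.prems(2) sim_sym by (auto simp: comm_def GamP_set_def Gam_def)
      then show ?thesis using Bs'(3) Cons.prems(1) True by auto
    next
      case F: False
      then have "first_block Bs' = first_block Bs" using Bs'(3) by argo
      then show ?thesis using Cons.prems(1) by simp
    qed
    then show ?thesis
      using False Bs' Cons.prems(1)
      by (intro exI[of _ "B # Bs'"]) (auto intro!: teq_append_left)
  qed
qed

lemma layered_exists: "set xs \<subseteq> F \<Longrightarrow> \<exists>Bs. layered GP Bs \<and> teq comm xs (word Bs)"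
proof (induction xs rule: rev_induct)
  case Nil
  show ?case by (intro exI[of _ "[]"]) (auto intro: teq_refl)
next
  case (snoc x xs)
  then obtain Bs where "layered GP Bs" "teq comm xs (word Bs)" by auto
  moreover obtain Bs' where "layered GP Bs'" "teq comm (word Bs @ [x]) (word Bs')"
    using layered_snoc[of Bs x] calculation snoc.prems by auto
  ultimately show ?case
    by (blast intro: teq_trans teq_append_right)
qed

text \<open>A choice of one layered word per trace. The chosen predicate depends on
  \<open>xs\<close> only through its class, so equivalent words get the same representative.\<close>

definition rep :: "'a set list \<Rightarrow> 'a set list" where
  "rep xs = (SOME ys. teq comm xs ys \<and> (\<exists>Bs. layered GP Bs \<and> ys = word Bs))"

lemma rep:
  assumes "set xs \<subseteq> F"
  shows "teq comm xs (rep xs)" "\<exists>Bs. layered GP Bs \<and> rep xs = word Bs"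
proof -
  have "teq comm xs (rep xs) \<and> (\<exists>Bs. layered GP Bs \<and> rep xs = word Bs)"
    unfolding rep_def by (rule someI_ex) (use layered_exists[OF assms] in blast)
  then show "teq comm xs (rep xs)" "\<exists>Bs. layered GP Bs \<and> rep xs = word Bs" by auto
qed

lemma rep_cong:
  assumes "teq comm xs ys"
  shows "rep xs = rep ys"
proof -
  have "teq comm xs zs \<longleftrightarrow> teq comm ys zs" for zs
    using teq_trans[OF assms] teq_trans[OF teq_sym[OF assms symp_comm]] by auto
  then show ?thesis by (simp add: rep_def)
qed

section \<open>Total weight of layered words\<close>

definition words :: "('a set set \<Rightarrow> 'a set set) \<Rightarrow> nat \<Rightarrow> 'a set set \<Rightarrow> 'a set list set" where
  "words N t R = {word Bs | Bs. layered N Bs \<and> first_block Bs = R \<and> length (word Bs) = t}"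

lemma finite_words_of_length: "finite {w::'a set list. P w \<and> length w = t}"
  by (rule finite_subset[OF _ finite_lists_length_eq[of UNIV t]]) auto

lemma finite_words: "finite (words N t R)"
  by (rule finite_subset[OF _ finite_words_of_length[of "\<lambda>_. True" t]]) (auto simp: words_def)

definition layered_words :: "nat \<Rightarrow> 'a set list set" where
  "layered_words t = {word Bs | Bs. layered GP Bs \<and> length (word Bs) = t}"

lemma finite_layered_words: "finite (layered_words t)"
  by (rule finite_subset[OF _ finite_words_of_length[of "\<lambda>_. True" t]]) (auto simp: layered_words_def)

text \<open>Strong induction on \<open>t\<close>, peeling off the first block: the remainder is
  bounded by \<open>\<theta> ^ (t - card R) * mu R'\<close> for each possible next block
  \<open>R'\<close>, and the hypothesis \<open>mu\<close> absorbs the sum over \<open>R'\<close>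
  together with the weight of \<open>R\<close>.\<close>

lemma sum_words_le:
  fixes lam :: "'a set \<Rightarrow> real"
  assumes \<theta>: "0 \<le> \<theta>"
    and lam: "\<And>f. f \<in> F \<Longrightarrow> 0 \<le> lam f"
    and mu_empty: "mu {} = 1"
    and mu_nonneg: "\<And>R. R \<in> Ind sim F \<Longrightarrow> 0 \<le> mu R"
    and mu: "\<And>R. R \<in> Ind sim F \<Longrightarrow>
      (\<Prod>f\<in>R. lam f) * (\<Sum>R'\<in>Ind sim (Gams F sim R). mu R') \<le> \<theta> ^ card R * mu R"
    and R: "R \<in> Ind sim F"
  shows "(\<Sum>w\<in>words (Gams F sim) t R. prod_list (map lam w)) \<le> \<theta> ^ t * mu R"
  using R
proof (induction t arbitrary: R rule: less_induct)
  case (less t)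
  let ?N = "Gams F sim"
  let ?W = "words ?N"
  have RF: "R \<subseteq> F" using less.prems by (rule Ind_subset)
  have GF: "Ind sim (?N R) \<subseteq> Ind sim F" by (rule Ind_mono) (auto simp: Gams_def Gam_def)
  have nonneg: "0 \<le> prod_list (map lam w)" if "set w \<subseteq> F" for w
    using that lam by (auto intro!: prod_list_nonneg simp: subset_iff)
  show ?case
  proof (cases "R = {}")
    case True
    \<comment> \<open>Blocks are nonempty, so only the empty sequence has the empty first
      block.\<close>
    have "layered ?N Bs \<and> first_block Bs = {} \<and> P \<longleftrightarrow> Bs = [] \<and> P" for Bs P
      by (cases Bs) auto
    then have "?W t R = (if t = 0 then {[]} else {})"
      using True by (simp add: words_def)
    then show ?thesis using True \<theta> mu_empty by auto
  next
    case False
    have split: "\<exists>R' w'. w = ordered R @ w' \<and> R' \<in> Ind sim (?N R) \<and> w' \<in> ?W (t - card R) R' \<and> card R \<le> t"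
      if w: "w \<in> ?W t R" for w
    proof -
      obtain Bs where Bs: "w = word Bs" "layered ?N Bs" "first_block Bs = R" "length (word Bs) = t"
        using w unfolding words_def by blast
      obtain Bs' where Bs': "Bs = R # Bs'" using Bs(3) False by (cases Bs) auto
      have "first_block Bs' \<in> Ind sim (?N R)"
        using first_block_Ind[of ?N Bs'] Bs(2) Bs' by (auto simp: Ind_def)
      moreover have "word Bs' \<in> ?W (t - card R) (first_block Bs')"
        using Bs Bs' length_ordered[OF RF] unfolding words_def by auto
      moreover have "card R \<le> t" "w = ordered R @ word Bs'"
        using Bs Bs' length_ordered[OF RF] by auto
      ultimately show ?thesis by blast
    qed
    have sub: "?W t R \<subseteq> (\<lambda>(R', w). ordered R @ w) ` (SIGMA R':Ind sim (?N R). ?W (t - card R) R')"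
    proof
      fix w assume "w \<in> ?W t R"
      then obtain R' w' where "w = ordered R @ w'" "R' \<in> Ind sim (?N R)" "w' \<in> ?W (t - card R) R'"
        using split by blast
      then show "w \<in> (\<lambda>(R', w). ordered R @ w) ` (SIGMA R':Ind sim (?N R). ?W (t - card R) R')"
        by (intro image_eqI[of _ _ "(R', w')"]) auto
    qed
    show ?thesis
    \<comment> \<open>If a word exists then \<open>card R \<le> t\<close>, so the natural
      subtraction \<open>t - card R\<close> is exact; otherwise the sum is 0.\<close>
    proof (cases "?W t R = {}")
      case True
      then show ?thesis using \<theta> mu_nonneg[OF less.prems] by simp
    next
      case ne: False
      then have le: "card R \<le> t" using split by blast
      have lt: "t - card R < t"
      proof -
        have "0 < card R" using False by (simp add: card_gt_0_iff)
        then show ?thesis using le by linarith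
      qed
      let ?S = "SIGMA R':Ind sim (?N R). ?W (t - card R) R'"
      have fin: "finite ?S" by (auto intro: finite_words)
      have SF: "set w \<subseteq> F" if "w \<in> ?W s R'" for w s R'
        using that set_word unfolding words_def by blast
      have nn: "0 \<le> prod_list (map lam (ordered R @ w))" if "w \<in> ?W s R'" for w s R'
        using SF[OF that] RF set_ordered[OF RF] by (intro nonneg) auto
      have lamR: "prod_list (map lam (ordered R)) = (\<Prod>f\<in>R. lam f)"
        using distinct_ordered[OF RF] set_ordered[OF RF] by (metis prod.distinct_set_conv_list)
      have lamR0: "0 \<le> (\<Prod>f\<in>R. lam f)" using RF lam by (auto intro!: prod_nonneg)
      have "(\<Sum>w\<in>?W t R. prod_list (map lam w))
          \<le> (\<Sum>w\<in>(\<lambda>(R', w). ordered R @ w) ` ?S. prod_list (map lam w))"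
        using nn by (intro sum_mono2 finite_imageI fin sub) auto
      also have "\<dots> \<le> (\<Sum>(R', w)\<in>?S. prod_list (map lam (ordered R @ w)))"
        using sum_image_le[OF fin, of "\<lambda>w. prod_list (map lam w)" "\<lambda>(R', w). ordered R @ w"]
          nn by (force simp: o_def case_prod_unfold)
      also have "\<dots> = (\<Sum>R'\<in>Ind sim (?N R). \<Sum>w\<in>?W (t - card R) R'. (\<Prod>f\<in>R. lam f) * prod_list (map lam w))"
        by (subst sum.Sigma[symmetric]) (auto simp: finite_words lamR)
      also have "\<dots> = (\<Prod>f\<in>R. lam f) * (\<Sum>R'\<in>Ind sim (?N R). \<Sum>w\<in>?W (t - card R) R'. prod_list (map lam w))"
        by (simp add: sum_distrib_left)
      also have "\<dots> \<le> (\<Prod>f\<in>R. lam f) * (\<Sum>R'\<in>Ind sim (?N R). \<theta> ^ (t - card R) * mu R')"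
        using GF by (intro mult_left_mono sum_mono less.IH lt lamR0) auto
      also have "\<dots> = \<theta> ^ (t - card R) * ((\<Prod>f\<in>R. lam f) * (\<Sum>R'\<in>Ind sim (?N R). mu R'))"
        by (simp add: sum_distrib_left mult_ac)
      also have "\<dots> \<le> \<theta> ^ (t - card R) * (\<theta> ^ card R * mu R)"
        using \<theta> by (intro mult_left_mono mu less.prems) auto
      also have "\<dots> = \<theta> ^ t * mu R"
        using le by (simp add: power_add[symmetric] mult.assoc[symmetric])
      finally show ?thesis .
    qed
  qed
qed

end

subsection \<open>Runs, walks and kernels\<close>

lemma nn_integral_pmf_finite_type:
  fixes p :: "'a::finite pmf" and g :: "'a \<Rightarrow> real"
  assumes "\<And>x. 0 \<le> g x"
  shows "(\<integral>\<^sup>+x. ennreal (g x) \<partial>measure_pmf p) = ennreal (\<Sum>x\<in>UNIV. pmf p x * g x)"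
  by (simp add: nn_integral_measure_pmf nn_integral_count_space_finite assms
      flip: ennreal_mult' sum_ennreal)

lemma cur_append [simp]: "cur (\<sigma>, xs @ [(f, \<sigma>')]) = \<sigma>'"
  by (simp add: cur_def)

lemma run_length:
  "h \<in> set_pmf (run F rho w0 S k) \<Longrightarrow>
    length (snd h) \<le> k \<and> (length (snd h) < k \<longrightarrow> flaws_at F (cur h) = {})"
proof (induction k arbitrary: h)
  case (Suc k)
  then show ?case by (fastforce split: if_splits)
qed auto

text \<open>A round extends only a history that has not stopped, and by \<open>run_length\<close>
  such a history has one step for every earlier round. Rounds after \<open>t\<close> therefore never
  bring a history to length \<open>t\<close> for the first time.\<close>

lemma run_prob_long_antimono:
  assumes "t \<le> k"
  shows "measure_pmf.prob (run F rho w0 S k) {h. t \<le> length (snd h)}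
    \<le> measure_pmf.prob (run F rho w0 S t) {h. length (snd h) = t}"
proof -
  let ?A = "{h. t \<le> length (snd h)}"
  have "emeasure (run F rho w0 S (t + m)) ?A \<le> emeasure (run F rho w0 S t) ?A" for m
  proof (induction m)
    case (Suc m)
    have "emeasure (run F rho w0 S (t + Suc m)) ?A
        = (\<integral>\<^sup>+h. (\<integral>\<^sup>+h'. indicator ?A h' \<partial>(if flaws_at F (cur h) = {} then return_pmf h
            else bind_pmf (S h) (\<lambda>f. map_pmf (\<lambda>\<sigma>'. (fst h, snd h @ [(f, \<sigma>')])) (rho f (cur h)))))
              \<partial>run F rho w0 S (t + m))"
      by (subst nn_integral_indicator[symmetric]) (auto simp del: nn_integral_indicator)
    also have "\<dots> \<le> (\<integral>\<^sup>+h. indicator ?A h \<partial>run F rho w0 S (t + m))"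
    proof (intro nn_integral_mono_AE, unfold AE_measure_pmf_iff, intro ballI)
      fix h assume "h \<in> set_pmf (run F rho w0 S (t + m))"
      from run_length[OF this] have *: "flaws_at F (cur h) \<noteq> {} \<Longrightarrow> h \<in> ?A" by auto
      show "(\<integral>\<^sup>+h'. indicator ?A h' \<partial>(if flaws_at F (cur h) = {} then return_pmf h
            else bind_pmf (S h) (\<lambda>f. map_pmf (\<lambda>\<sigma>'. (fst h, snd h @ [(f, \<sigma>')])) (rho f (cur h)))))
          \<le> indicator ?A h"
      proof (cases "flaws_at F (cur h) = {}")
        case False
        then have "indicator ?A h = (1::ennreal)" using * by simp
        then show ?thesis using measure_pmf.emeasure_le_1 by (simp add: nn_integral_indicator del: nn_integral_bind_pmf)
      qed simp
    qed
    also have "\<dots> \<le> emeasure (run F rho w0 S t) ?A"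
      using Suc by simp
    finally show ?case .
  qed simp
  from this[of "k - t"] assms have "emeasure (run F rho w0 S k) ?A \<le> emeasure (run F rho w0 S t) ?A"
    by simp
  also have "\<dots> = emeasure (run F rho w0 S t) {h. length (snd h) = t}"
    by (rule emeasure_eq_AE) (auto simp: AE_measure_pmf_iff dest: run_length)
  finally show ?thesis by (simp add: measure_pmf.emeasure_eq_measure)
qed

text \<open>A supermartingale bound: \<open>E k\<close> averages the potential over the runs that
  have made exactly \<open>k\<close> steps. By \<open>step\<close> it does not increase, and by
  \<open>final\<close> it dominates the wanted probability at time \<open>t\<close>.\<close>

lemma run_potential:
  fixes \<Psi> :: "nat \<Rightarrow> 'a::finite hist \<Rightarrow> ennreal"
  assumes step: "\<And>k h f. k < t \<Longrightarrow> h \<in> set_pmf (run F rho w0 S k) \<Longrightarrow> length (snd h) = k \<Longrightarrow>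
      flaws_at F (cur h) \<noteq> {} \<Longrightarrow> f \<in> set_pmf (S h) \<Longrightarrow>
      (\<integral>\<^sup>+\<sigma>'. \<Psi> (Suc k) (fst h, snd h @ [(f, \<sigma>')]) \<partial>rho f (cur h)) \<le> \<Psi> k h"
    and final: "\<And>h. h \<in> set_pmf (run F rho w0 S t) \<Longrightarrow> length (snd h) = t \<Longrightarrow> 1 \<le> \<Psi> t h"
  shows "emeasure (run F rho w0 S t) {h. length (snd h) = t} \<le> (\<integral>\<^sup>+\<sigma>. \<Psi> 0 (\<sigma>, []) \<partial>w0)"
proof -
  define E where "E k = (\<integral>\<^sup>+h. indicator {h. length (snd h) = k} h * \<Psi> k h \<partial>run F rho w0 S k)" for k
  have "E k \<le> E 0" if "k \<le> t" for k
    using that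
  proof (induction k)
    case (Suc k)
    let ?I = "\<lambda>h. indicator {h. length (snd h) = Suc k} h * \<Psi> (Suc k) h :: ennreal"
    have "E (Suc k) = (\<integral>\<^sup>+h. (\<integral>\<^sup>+h'. ?I h' \<partial>(if flaws_at F (cur h) = {} then return_pmf h
            else bind_pmf (S h) (\<lambda>f. map_pmf (\<lambda>\<sigma>'. (fst h, snd h @ [(f, \<sigma>')])) (rho f (cur h)))))
              \<partial>run F rho w0 S k)"
      unfolding E_def by simp
    also have "\<dots> \<le> E k"
      unfolding E_def
    proof (intro nn_integral_mono_AE, unfold AE_measure_pmf_iff, intro ballI)
      fix h assume h: "h \<in> set_pmf (run F rho w0 S k)"
      show "(\<integral>\<^sup>+h'. ?I h' \<partial>(if flaws_at F (cur h) = {} then return_pmf h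
            else bind_pmf (S h) (\<lambda>f. map_pmf (\<lambda>\<sigma>'. (fst h, snd h @ [(f, \<sigma>')])) (rho f (cur h)))))
          \<le> indicator {h. length (snd h) = k} h * \<Psi> k h"
      proof (cases "flaws_at F (cur h) = {}")
        \<comment> \<open>A stopped history keeps its length, at most \<open>k\<close>, so the
          indicator for \<open>Suc k\<close> vanishes.\<close>
        case True
        then show ?thesis using run_length[OF h] by simp
      next
        case False
        then have len: "length (snd h) = k" using run_length[OF h] by force
        have "(\<integral>\<^sup>+f. \<integral>\<^sup>+\<sigma>'. \<Psi> (Suc k) (fst h, snd h @ [(f, \<sigma>')]) \<partial>rho f (cur h) \<partial>S h)
            \<le> (\<integral>\<^sup>+f. \<Psi> k h \<partial>S h)"
          using Suc.prems by (intro nn_integral_mono_AE) (auto simp: AE_measure_pmf_iff intro!: step h len False)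
        then show ?thesis using False len by simp
      qed
    qed
    also have "\<dots> \<le> E 0" using Suc by simp
    finally show ?case .
  qed simp
  then have "E t \<le> E 0" by simp
  moreover have "emeasure (run F rho w0 S t) {h. length (snd h) = t} \<le> E t"
    unfolding E_def
  proof (subst nn_integral_indicator[symmetric], simp, intro nn_integral_mono_AE,
      unfold AE_measure_pmf_iff, intro ballI)
    fix h assume "h \<in> set_pmf (run F rho w0 S t)"
    then show "indicator {h. length (snd h) = t} h \<le> indicator {h. length (snd h) = t} h * \<Psi> t h"
      using final[of h] by (cases "length (snd h) = t") simp_all
  qed
  ultimately show ?thesis by (simp add: E_def)
qed

section \<open>Walks and causality\<close>

fun reach :: "'a set set \<Rightarrow> ('a set \<Rightarrow> 'a \<Rightarrow> 'a pmf) \<Rightarrow> 'a set list \<Rightarrow> 'a \<Rightarrow> 'a set" where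
  "reach F rho [] \<sigma> = {\<sigma>}"
| "reach F rho (f # w) \<sigma> = (\<Union>\<sigma>'\<in>{\<sigma>'. valid_step F rho \<sigma> f \<sigma>'}. reach F rho w \<sigma>')"

lemma reach_append: "reach F rho (u @ v) \<sigma> = (\<Union>\<sigma>'\<in>reach F rho u \<sigma>. reach F rho v \<sigma>')"
  by (induction u arbitrary: \<sigma>) auto

locale flaw_system = flaw_order F sim \<pi>
  for F :: "'a::finite set set" and sim \<pi> +
  fixes rho :: "'a set \<Rightarrow> 'a \<Rightarrow> 'a pmf"
  assumes causality: "valid_step F rho \<sigma> f \<sigma>' \<Longrightarrow>
    flaws_at F \<sigma>' \<subseteq> (flaws_at F \<sigma> - {f}) \<union> Gam F sim f"
begin

text \<open>No letter of an independent block lies in \<Gamma> of an earlier letter, so none is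
  caused inside the block and all are present at its start. Afterwards a letter of the block can be
  present only if it lies in \<Gamma> of the block.\<close>

lemma reach_independent:
  assumes "\<sigma>' \<in> reach F rho xs \<sigma>" "distinct xs" "set xs \<in> Ind sim F"
  shows "set xs \<subseteq> flaws_at F \<sigma> \<and> flaws_at F \<sigma>' \<subseteq> (flaws_at F \<sigma> - set xs) \<union> Gams F sim (set xs)"
  using assms
proof (induction xs arbitrary: \<sigma>)
  case (Cons f xs)
  then obtain \<sigma>1 where \<sigma>1: "valid_step F rho \<sigma> f \<sigma>1" "\<sigma>' \<in> reach F rho xs \<sigma>1" by auto
  have "set xs \<in> Ind sim F" using Cons.prems(3) by (auto simp: Ind_def)
  then have IH: "set xs \<subseteq> flaws_at F \<sigma>1"
    "flaws_at F \<sigma>' \<subseteq> (flaws_at F \<sigma>1 - set xs) \<union> Gams F sim (set xs)"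
    using Cons.IH[OF \<sigma>1(2)] Cons.prems(2) by auto
  have "set xs \<inter> Gam F sim f = {}"
    using Cons.prems(2,3) by (auto simp: Ind_def Gam_def)
  moreover have "f \<in> flaws_at F \<sigma>" using \<sigma>1(1) by (simp add: valid_step_def)
  moreover have "Gams F sim (set (f # xs)) = Gam F sim f \<union> Gams F sim (set xs)"
    by (simp add: Gams_def)
  ultimately show ?case using IH causality[OF \<sigma>1(1)] by auto
qed simp

text \<open>Flaws present after block \<open>B\<close> avoid \<open>B\<close> except inside
  \<open>Gams F sim B\<close>, which sharpens the containment in \<open>GP B\<close>. The first
  block must be present at the start of the walk; this is where the initial family of independent
  sets enters.\<close>

lemma layered_reach:
  assumes "layered GP Bs" "reach F rho (word Bs) \<sigma> \<noteq> {}"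
  shows "layered (Gams F sim) Bs \<and> first_block Bs \<in> Ind sim (flaws_at F \<sigma>)"
  using assms
proof (induction Bs arbitrary: \<sigma>)
  case (Cons B Bs)
  have B: "B \<in> Ind sim F" "B \<subseteq> F" using Cons.prems Ind_subset by auto
  obtain \<sigma>' where \<sigma>': "\<sigma>' \<in> reach F rho (ordered B) \<sigma>" "reach F rho (word Bs) \<sigma>' \<noteq> {}"
    using Cons.prems(2) by (auto simp: reach_append)
  have r: "B \<subseteq> flaws_at F \<sigma>" "flaws_at F \<sigma>' \<subseteq> (flaws_at F \<sigma> - B) \<union> Gams F sim B"
    using reach_independent[OF \<sigma>'(1)] B by (auto simp: distinct_ordered set_ordered)
  have "layered (Gams F sim) Bs" "first_block Bs \<subseteq> flaws_at F \<sigma>'"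
    using Cons.IH[OF _ \<sigma>'(2)] Cons.prems(1) Ind_subset by auto
  moreover have "first_block Bs \<subseteq> B \<union> Gams F sim B"
    using Cons.prems(1) by (simp add: GamP_set_eq)
  ultimately have "first_block Bs \<subseteq> Gams F sim B" using r by blast
  with Cons.prems B r \<open>layered (Gams F sim) Bs\<close> show ?case by (auto simp: Ind_def)
qed (simp add: Ind_def)

end

section \<open>Dominating kernels and their potentials\<close>

locale flaw_kernel = flaw_system F sim \<pi> rho
  for F :: "'a::finite set set" and sim \<pi> rho +
  fixes \<omega> :: "'a pmf" and lam :: "'a set \<Rightarrow> real" and K :: "'a set \<Rightarrow> 'a \<Rightarrow> 'a \<Rightarrow> real"
  assumes \<omega>_pos: "0 < pmf \<omega> \<sigma>"
    and lam_nonneg: "f \<in> F \<Longrightarrow> 0 \<le> lam f"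
    and K_nonneg: "0 \<le> K f \<sigma> \<sigma>'"
    and K_valid: "K f \<sigma> \<sigma>' \<noteq> 0 \<Longrightarrow> valid_step F rho \<sigma> f \<sigma>'"
    and K_dominates: "f \<in> flaws_at F \<sigma> \<Longrightarrow> pmf (rho f \<sigma>) \<sigma>' \<le> K f \<sigma> \<sigma>'"
    and K_\<omega>: "f \<in> F \<Longrightarrow> (\<Sum>\<sigma>\<in>UNIV. pmf \<omega> \<sigma> * K f \<sigma> \<sigma>') \<le> lam f * pmf \<omega> \<sigma>'"
begin

text \<open>\<open>G w\<close> is the vector \<open>K\<^sub>w 1\<close>: the total
  \<open>K\<close>-weight of the walks along \<open>w\<close> from a given state.\<close>

primrec G :: "'a set list \<Rightarrow> 'a \<Rightarrow> real" where
  "G [] \<sigma> = 1"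
| "G (f # w) \<sigma> = (\<Sum>\<sigma>'\<in>UNIV. K f \<sigma> \<sigma>' * G w \<sigma>')"

lemma G_nonneg: "0 \<le> G w \<sigma>"
  by (induction w arbitrary: \<sigma>) (auto intro!: sum_nonneg mult_nonneg_nonneg K_nonneg)

lemma G_reach: "G w \<sigma> \<noteq> 0 \<Longrightarrow> reach F rho w \<sigma> \<noteq> {}"
proof (induction w arbitrary: \<sigma>)
  case (Cons f w)
  from Cons.prems obtain \<sigma>' where "K f \<sigma> \<sigma>' * G w \<sigma>' \<noteq> 0"
    unfolding G.simps by (rule sum.not_neutral_contains_not_neutral)
  then show ?case using Cons.IH[of \<sigma>'] K_valid[of f \<sigma> \<sigma>'] by auto
qed simp

text \<open>The row vector \<open>\<omega>\<close> is pushed through the matrices from the left,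
  each letter \<open>f\<close> costing a factor \<open>lam f\<close> by
  \<open>K_\<omega>\<close>.\<close>

lemma sum_\<omega>_G_le: "set w \<subseteq> F \<Longrightarrow> (\<Sum>\<sigma>\<in>UNIV. pmf \<omega> \<sigma> * G w \<sigma>) \<le> prod_list (map lam w)"
proof (induction w)
  case Nil
  then show ?case by (simp add: sum_pmf_eq_1)
next
  case (Cons f w)
  have "(\<Sum>\<sigma>\<in>UNIV. pmf \<omega> \<sigma> * G (f # w) \<sigma>) = (\<Sum>\<sigma>'\<in>UNIV. (\<Sum>\<sigma>\<in>UNIV. pmf \<omega> \<sigma> * K f \<sigma> \<sigma>') * G w \<sigma>')"
    unfolding G.simps sum_distrib_left sum_distrib_right by (subst sum.swap) (simp add: mult_ac)
  also have "\<dots> \<le> (\<Sum>\<sigma>'\<in>UNIV. lam f * pmf \<omega> \<sigma>' * G w \<sigma>')"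
    using Cons.prems by (intro sum_mono mult_right_mono K_\<omega> G_nonneg) auto
  also have "\<dots> = lam f * (\<Sum>\<sigma>'\<in>UNIV. pmf \<omega> \<sigma>' * G w \<sigma>')"
    by (simp add: sum_distrib_left mult.assoc)
  also have "\<dots> \<le> lam f * prod_list (map lam w)"
    using Cons by (intro mult_left_mono lam_nonneg) auto
  finally show ?case by simp
qed

lemma G_step:
  assumes "f \<in> flaws_at F \<sigma>" "finite L"
  shows "(\<integral>\<^sup>+\<sigma>'. ennreal (\<Sum>w\<in>L. G w \<sigma>') \<partial>rho f \<sigma>) \<le> ennreal (\<Sum>w\<in>L. G (f # w) \<sigma>)"
proof -
  have "(\<integral>\<^sup>+\<sigma>'. ennreal (\<Sum>w\<in>L. G w \<sigma>') \<partial>rho f \<sigma>) = ennreal (\<Sum>\<sigma>'\<in>UNIV. pmf (rho f \<sigma>) \<sigma>' * (\<Sum>w\<in>L. G w \<sigma>'))"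
    by (intro nn_integral_pmf_finite_type sum_nonneg G_nonneg)
  also have "\<dots> \<le> ennreal (\<Sum>\<sigma>'\<in>UNIV. K f \<sigma> \<sigma>' * (\<Sum>w\<in>L. G w \<sigma>'))"
    using assms by (intro ennreal_leI sum_mono mult_right_mono K_dominates sum_nonneg G_nonneg)
  also have "(\<Sum>\<sigma>'\<in>UNIV. K f \<sigma> \<sigma>' * (\<Sum>w\<in>L. G w \<sigma>')) = (\<Sum>w\<in>L. G (f # w) \<sigma>)"
    unfolding G.simps sum_distrib_left by (rule sum.swap)
  finally show ?thesis .
qed

text \<open>The potential sums \<open>G\<close> of the unread suffix over all layered words that
  extend the word of the history. A step along \<open>f\<close> keeps those continuing with
  \<open>f\<close>; at the end exactly the word of the run is left, with value 1.\<close>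

lemma run_le_layered_if_layered:
  assumes strat: "valid_strategy F S"
    and lay: "\<And>h. h \<in> set_pmf (run F rho w0 S t) \<Longrightarrow> \<exists>Bs. layered GP Bs \<and> map fst (snd h) = word Bs"
  shows "emeasure (run F rho w0 S t) {h. length (snd h) = t}
    \<le> (\<integral>\<^sup>+\<sigma>. ennreal (\<Sum>w\<in>layered_words t. G w \<sigma>) \<partial>w0)"
proof -
  let ?L = "layered_words t"
  define \<Psi> where "\<Psi> k h = ennreal (\<Sum>w | w \<in> ?L \<and> take k w = map fst (snd h). G (drop k w) (cur h))"
    for k and h :: "'a hist"
  have "emeasure (run F rho w0 S t) {h. length (snd h) = t} \<le> (\<integral>\<^sup>+\<sigma>. \<Psi> 0 (\<sigma>, []) \<partial>w0)"
  proof (rule run_potential)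
    fix k h f
    assume k: "k < t" and len: "length (snd h) = k" and live: "flaws_at F (cur h) \<noteq> {}"
      and f: "f \<in> set_pmf (S h)"
    have f': "f \<in> flaws_at F (cur h)" using strat live f unfolding valid_strategy_def by blast
    let ?M = "{w \<in> ?L. take (Suc k) w = map fst (snd h) @ [f]}"
    have finM: "finite ?M" by (simp add: finite_layered_words)
    have M: "take k w = map fst (snd h) \<and> drop k w = f # drop (Suc k) w" if "w \<in> ?M" for w
    proof -
      have "length w = t" using that by (auto simp: layered_words_def)
      then have "take (Suc k) w = take k w @ [w ! k]" "drop k w = w ! k # drop (Suc k) w"
        using k by (simp_all add: take_Suc_conv_app_nth Cons_nth_drop_Suc)
      then show ?thesis using that by auto
    qed
    \<comment> \<open>All words in \<open>?M\<close> share their first \<open>Suc k\<close>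
      letters.\<close>
    have inj: "inj_on (drop (Suc k)) ?M"
      by (intro inj_onI) (metis (mono_tags, lifting) append_take_drop_id mem_Collect_eq)
    have "(\<integral>\<^sup>+\<sigma>'. \<Psi> (Suc k) (fst h, snd h @ [(f, \<sigma>')]) \<partial>rho f (cur h))
        = (\<integral>\<^sup>+\<sigma>'. ennreal (\<Sum>w\<in>drop (Suc k) ` ?M. G w \<sigma>') \<partial>rho f (cur h))"
      by (simp add: \<Psi>_def sum.reindex[OF inj])
    also have "\<dots> \<le> ennreal (\<Sum>w\<in>drop (Suc k) ` ?M. G (f # w) (cur h))"
      by (rule G_step[OF f' finite_imageI[OF finM]])
    also have "\<dots> = ennreal (\<Sum>w\<in>?M. G (drop k w) (cur h))"
      using M by (simp add: sum.reindex[OF inj] del: G.simps)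
    also have "\<dots> \<le> \<Psi> k h"
      unfolding \<Psi>_def using M
      by (intro ennreal_leI sum_mono2) (auto simp: finite_layered_words G_nonneg)
    finally show "(\<integral>\<^sup>+\<sigma>'. \<Psi> (Suc k) (fst h, snd h @ [(f, \<sigma>')]) \<partial>rho f (cur h)) \<le> \<Psi> k h" .
  next
    fix h assume h: "h \<in> set_pmf (run F rho w0 S t)" and len: "length (snd h) = t"
    let ?w = "map fst (snd h)"
    have "?w \<in> ?L" using lay[OF h] len unfolding layered_words_def by (metis (mono_tags, lifting) length_map mem_Collect_eq)
    moreover have "take t w = w" if "w \<in> ?L" for w using that by (auto simp: layered_words_def)
    ultimately have "{w \<in> ?L. take t w = ?w} = {?w}" using len by auto
    then show "1 \<le> \<Psi> t h" using len by (simp add: \<Psi>_def)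
  qed
  then show ?thesis by (simp add: \<Psi>_def cur_def)
qed

lemma G_teq:
  assumes commute: "\<And>f g \<sigma> \<sigma>'. comm f g \<Longrightarrow>
      (\<Sum>\<tau>\<in>UNIV. K f \<sigma> \<tau> * K g \<tau> \<sigma>') = (\<Sum>\<tau>\<in>UNIV. K g \<sigma> \<tau> * K f \<tau> \<sigma>')"
    and "teq comm xs ys"
  shows "G xs \<sigma> = G ys \<sigma>"
  using assms(2)
proof (induction arbitrary: \<sigma> rule: teq.induct)
  case (teq_swap f g xs)
  have "G (f # g # xs) \<sigma> = (\<Sum>\<sigma>'\<in>UNIV. (\<Sum>\<tau>\<in>UNIV. K f \<sigma> \<tau> * K g \<tau> \<sigma>') * G xs \<sigma>')" for f g
    unfolding G.simps sum_distrib_left sum_distrib_right by (subst sum.swap) (simp add: mult.assoc)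
  then show ?case using commute[OF teq_swap] by simp
qed auto

text \<open>Here the potential forgets the past: it sums \<open>G\<close> at the current state over
  one representative of each trace of length \<open>t - k\<close>. Prefixing the addressed flaw maps
  traces of length \<open>t - Suc k\<close> injectively to traces of length \<open>t - k\<close>
  and, by commutation, preserves \<open>G\<close> when the representative is changed, whichever flaw
  is selected.\<close>

lemma run_le_layered_if_commute:
  assumes commute: "\<And>f g \<sigma> \<sigma>'. comm f g \<Longrightarrow>
      (\<Sum>\<tau>\<in>UNIV. K f \<sigma> \<tau> * K g \<tau> \<sigma>') = (\<Sum>\<tau>\<in>UNIV. K g \<sigma> \<tau> * K f \<tau> \<sigma>')"
    and strat: "valid_strategy F S"
  shows "emeasure (run F rho w0 S t) {h. length (snd h) = t}
    \<le> (\<integral>\<^sup>+\<sigma>. ennreal (\<Sum>w\<in>layered_words t. G w \<sigma>) \<partial>w0)"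
proof -
  define Reps where "Reps s = rep ` {w. set w \<subseteq> F \<and> length w = s}" for s
  have fin: "finite (Reps s)" for s
    by (simp add: Reps_def finite_words_of_length)
  have Reps_F: "set w \<subseteq> F" "rep w = w" "length w = s" if "w \<in> Reps s" for w s
  proof -
    obtain v where v: "set v \<subseteq> F" "length v = s" "w = rep v" using \<open>w \<in> Reps s\<close> by (auto simp: Reps_def)
    have "teq comm v w" using rep(1)[OF v(1)] v(3) by simp
    from teq_set[OF this] teq_length[OF this] v(1,2) show "set w \<subseteq> F" "length w = s" by simp_all
    from rep_cong[OF \<open>teq comm v w\<close>] v(3) show "rep w = w" by (rule trans[OF sym sym])
  qed
  \<comment> \<open>The unsimplified \<open>t - 0\<close> and \<open>cur (\<sigma>, [])\<close>
    present the right side as the potential at time 0.\<close>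
  have "emeasure (run F rho w0 S t) {h. length (snd h) = t}
      \<le> (\<integral>\<^sup>+\<sigma>. ennreal (\<Sum>w\<in>Reps (t - 0). G w (cur (\<sigma>, []))) \<partial>w0)"
  proof (rule run_potential[where \<Psi> = "\<lambda>k h. ennreal (\<Sum>w\<in>Reps (t - k). G w (cur h))"])
    fix k h f
    assume k: "k < t" and live: "flaws_at F (cur h) \<noteq> {}" and f: "f \<in> set_pmf (S h)"
    have f': "f \<in> flaws_at F (cur h)" using strat live f unfolding valid_strategy_def by blast
    then have fF: "f \<in> F" by (simp add: flaws_at_def)
    let ?R = "Reps (t - Suc k)"
    have eq: "teq comm (f # w) (rep (f # w))" if "w \<in> ?R" for w
      using Reps_F[OF that] fF by (intro rep(1)) auto
    \<comment> \<open>Equal representatives mean equivalent words \<open>f # v\<close> and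
      \<open>f # w\<close>; cancelling \<open>f\<close> makes \<open>v\<close> and \<open>w\<close>
      equivalent, and they are representatives themselves.\<close>
    have inj: "inj_on (\<lambda>w. rep (f # w)) ?R"
    proof (rule inj_onI)
      fix v w assume v: "v \<in> ?R" and w: "w \<in> ?R" and e: "rep (f # v) = rep (f # w)"
      have "teq comm (f # v) (f # w)"
        using eq[OF v] teq_sym[OF eq[OF w] symp_comm] e by (auto intro: teq_trans)
      then have "rep v = rep w" by (rule rep_cong[OF teq_Cons_cancel])
      then show "v = w" using Reps_F(2)[OF v] Reps_F(2)[OF w] by argo
    qed
    have "(\<integral>\<^sup>+\<sigma>'. ennreal (\<Sum>w\<in>?R. G w (cur (fst h, snd h @ [(f, \<sigma>')]))) \<partial>rho f (cur h))
        \<le> ennreal (\<Sum>w\<in>?R. G (f # w) (cur h))"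
      using G_step[OF f' fin] by simp
    also have "(\<Sum>w\<in>?R. G (f # w) (cur h)) = (\<Sum>w\<in>?R. G (rep (f # w)) (cur h))"
      by (rule sum.cong[OF refl], rule G_teq[OF commute eq])
    also have "\<dots> = (\<Sum>w\<in>(\<lambda>w. rep (f # w)) ` ?R. G w (cur h))"
      by (simp add: sum.reindex[OF inj])
    also have "ennreal (\<Sum>w\<in>(\<lambda>w. rep (f # w)) ` ?R. G w (cur h)) \<le> ennreal (\<Sum>w\<in>Reps (t - k). G w (cur h))"
    proof (intro ennreal_leI sum_mono2 fin G_nonneg)
      show "(\<lambda>w. rep (f # w)) ` ?R \<subseteq> Reps (t - k)"
      proof
        fix v assume "v \<in> (\<lambda>w. rep (f # w)) ` ?R"
        then obtain w where w: "w \<in> ?R" "v = rep (f # w)" by auto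
        have "set (f # w) \<subseteq> F" "length (f # w) = t - k" using Reps_F[OF w(1)] fF k by auto
        then show "v \<in> Reps (t - k)" unfolding w(2) Reps_def by blast
      qed
    qed
    finally show "(\<integral>\<^sup>+\<sigma>'. ennreal (\<Sum>w\<in>?R. G w (cur (fst h, snd h @ [(f, \<sigma>')]))) \<partial>rho f (cur h))
        \<le> ennreal (\<Sum>w\<in>Reps (t - k). G w (cur h))" .
  next
    fix h
    have "rep [] = []" using teq_length[OF rep(1)[of "[]"]] by simp
    then have "Reps 0 = {[]}" by (auto simp: Reps_def intro: image_eqI[of _ _ "[]"])
    then show "1 \<le> ennreal (\<Sum>w\<in>Reps (t - t). G w (cur h))" by simp
  qed
  also have "\<dots> \<le> (\<integral>\<^sup>+\<sigma>. ennreal (\<Sum>w\<in>layered_words t. G w \<sigma>) \<partial>w0)"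
  proof (intro nn_integral_mono ennreal_leI)
    fix \<sigma>
    have "Reps t \<subseteq> layered_words t"
    proof
      fix w assume w: "w \<in> Reps t"
      then show "w \<in> layered_words t"
        using rep(2)[OF Reps_F(1)[OF w]] Reps_F(2,3)[OF w] unfolding layered_words_def by auto
    qed
    then show "(\<Sum>w\<in>Reps (t - 0). G w (cur (\<sigma>, []))) \<le> (\<Sum>w\<in>layered_words t. G w \<sigma>)"
      by (simp add: cur_def sum_mono2 finite_layered_words G_nonneg)
  qed
  finally show ?thesis .
qed

text \<open>Words of nonzero weight from the support of \<open>w0\<close> are layered in the
  stronger sense with first block in \<open>J\<close>. Replacing \<open>w0\<close> by
  \<open>\<gamma>\<close> times \<open>\<omega>\<close> leaves their products of \<open>lam\<close>,
  which \<open>sum_words_le\<close> bounds for each first block.\<close>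

lemma layered_bound:
  assumes \<theta>: "0 \<le> \<theta>"
    and mu_empty: "mu {} = 1"
    and mu_nonneg: "\<And>R. R \<in> Ind sim F \<Longrightarrow> 0 \<le> mu R"
    and mu: "\<And>R. R \<in> Ind sim F \<Longrightarrow>
      (\<Prod>f\<in>R. lam f) * (\<Sum>R'\<in>Ind sim (Gams F sim R). mu R') \<le> \<theta> ^ card R * mu R"
    and \<gamma>: "0 \<le> \<gamma>" "\<And>\<sigma>. pmf w0 \<sigma> \<le> \<gamma> * pmf \<omega> \<sigma>"
    and J: "J \<subseteq> Ind sim F" "\<And>\<sigma>. \<sigma> \<in> set_pmf w0 \<Longrightarrow> Ind sim (flaws_at F \<sigma>) \<subseteq> J"
  shows "(\<integral>\<^sup>+\<sigma>. ennreal (\<Sum>w\<in>layered_words t. G w \<sigma>) \<partial>w0) \<le> ennreal (\<gamma> * \<theta> ^ t * (\<Sum>R\<in>J. mu R))"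
proof -
  let ?W = "words (Gams F sim) t"
  let ?L = "\<Union>R\<in>J. ?W R"
  have finL: "finite ?L" by (auto intro: finite_words)
  have LF: "set w \<subseteq> F" if "w \<in> ?W R" for w R
    using that set_word unfolding words_def by blast
  have pos: "0 \<le> prod_list (map lam w)" if "set w \<subseteq> F" for w
    using that by (auto intro!: prod_list_nonneg lam_nonneg simp: subset_iff)
  have supp: "w \<in> ?L" if w: "w \<in> layered_words t" and \<sigma>: "pmf w0 \<sigma> * G w \<sigma> \<noteq> 0" for w \<sigma>
  proof -
    obtain Bs where Bs: "layered GP Bs" "w = word Bs" "length w = t"
      using w by (auto simp: layered_words_def)
    have "layered (Gams F sim) Bs" "first_block Bs \<in> Ind sim (flaws_at F \<sigma>)"
      using layered_reach[OF Bs(1), of \<sigma>] G_reach[of w \<sigma>] \<sigma> Bs(2) by auto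
    then show ?thesis using J(2)[of \<sigma>] \<sigma> Bs unfolding words_def by (auto simp: set_pmf_iff)
  qed
  have eq: "(\<integral>\<^sup>+\<sigma>. ennreal (\<Sum>w\<in>layered_words t. G w \<sigma>) \<partial>w0)
      = ennreal (\<Sum>\<sigma>\<in>UNIV. \<Sum>w\<in>layered_words t. pmf w0 \<sigma> * G w \<sigma>)"
    by (simp add: nn_integral_pmf_finite_type sum_nonneg G_nonneg sum_distrib_left)
  have "(\<Sum>\<sigma>\<in>UNIV. \<Sum>w\<in>layered_words t. pmf w0 \<sigma> * G w \<sigma>)
      \<le> (\<Sum>\<sigma>\<in>UNIV. \<Sum>w\<in>?L. pmf w0 \<sigma> * G w \<sigma>)"
  proof (rule sum_mono)
    fix \<sigma>
    have "(\<Sum>w\<in>layered_words t. pmf w0 \<sigma> * G w \<sigma>) = (\<Sum>w\<in>layered_words t \<inter> ?L. pmf w0 \<sigma> * G w \<sigma>)"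
      using supp[of _ \<sigma>] by (intro sum.mono_neutral_right finite_layered_words) auto
    also have "\<dots> \<le> (\<Sum>w\<in>?L. pmf w0 \<sigma> * G w \<sigma>)"
      by (intro sum_mono2 finL) (auto simp: G_nonneg)
    finally show "(\<Sum>w\<in>layered_words t. pmf w0 \<sigma> * G w \<sigma>) \<le> (\<Sum>w\<in>?L. pmf w0 \<sigma> * G w \<sigma>)" .
  qed
  also have "\<dots> \<le> (\<Sum>\<sigma>\<in>UNIV. \<Sum>w\<in>?L. \<gamma> * pmf \<omega> \<sigma> * G w \<sigma>)"
    by (intro sum_mono mult_right_mono \<gamma> G_nonneg)
  also have "\<dots> = \<gamma> * (\<Sum>w\<in>?L. \<Sum>\<sigma>\<in>UNIV. pmf \<omega> \<sigma> * G w \<sigma>)"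
    by (subst sum.swap) (simp add: sum_distrib_left mult.assoc)
  also have "\<dots> \<le> \<gamma> * (\<Sum>w\<in>?L. prod_list (map lam w))"
    using LF by (intro mult_left_mono sum_mono sum_\<omega>_G_le \<gamma>) blast
  also have "\<dots> \<le> \<gamma> * (\<Sum>R\<in>J. \<Sum>w\<in>?W R. prod_list (map lam w))"
  proof (rule mult_left_mono[OF _ \<gamma>(1)])
    have "?L = snd ` (SIGMA R:J. ?W R)" by force
    then have "(\<Sum>w\<in>?L. prod_list (map lam w)) \<le> (\<Sum>(R, w)\<in>(SIGMA R:J. ?W R). prod_list (map lam w))"
      using sum_image_le[of "SIGMA R:J. ?W R" "\<lambda>w. prod_list (map lam w)" snd] LF
      by (force intro!: pos finite_words simp: o_def case_prod_unfold)
    then show "(\<Sum>w\<in>?L. prod_list (map lam w)) \<le> (\<Sum>R\<in>J. \<Sum>w\<in>?W R. prod_list (map lam w))"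
      by (simp add: sum.Sigma finite_words)
  qed
  also have "\<dots> \<le> \<gamma> * (\<Sum>R\<in>J. \<theta> ^ t * mu R)"
    using J(1) by (intro mult_left_mono \<gamma> sum_mono sum_words_le \<theta> lam_nonneg mu_empty mu_nonneg mu) auto
  also have "\<dots> = \<gamma> * \<theta> ^ t * (\<Sum>R\<in>J. mu R)"
    by (simp add: sum_distrib_left mult.assoc)
  finally show ?thesis unfolding eq by (rule ennreal_leI)
qed

end

subsection \<open>Stable strategies and the kernels of commutative systems\<close>

text \<open>\<open>stable_I\<close> consumes a history from the front, whereas a run grows at its
  end.\<close>

lemma stable_I_snoc:
  "stable_I F sim \<sigma> I (xs @ [(f, \<sigma>')]) =
    (let J = stable_I F sim \<sigma> I xs in
      if flaws_at F (cur (\<sigma>, xs)) - GamP_set F sim J = {} then {f} else insert f J)"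
proof (induction xs arbitrary: \<sigma> I)
  case (Cons x xs)
  obtain g \<tau> where x: "x = (g, \<tau>)" by fastforce
  have "cur (\<sigma>, (g, \<tau>) # xs) = cur (\<tau>, xs)" by (simp add: cur_def)
  then show ?case using Cons by (simp add: x)
qed (simp add: cur_def)

context flaw_system
begin

text \<open>Here \<open>I\<close> is the set of the current round of Algorithm 2, and \<open>D\<close> collects the flaws that
  may be addressed in this round: apart from flaws in \<open>\<Gamma>(I)\<close>, no new ones appear before
  the round ends.\<close>

definition stable_inv :: "'a hist \<Rightarrow> 'a set set list \<Rightarrow> 'a set set \<Rightarrow> 'a set set \<Rightarrow> bool" where
  "stable_inv h Bs I D \<longleftrightarrow>
    map fst (snd h) = word Bs @ ordered I \<and> layered GP Bs \<and> I \<in> Ind sim F \<and> I \<subseteq> D \<and>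
    (Bs \<noteq> [] \<longrightarrow> D \<subseteq> GP (last Bs)) \<and> flaws_at F (cur h) \<subseteq> D \<union> Gams F sim I \<and>
    (\<forall>g\<in>I. \<forall>f\<in>flaws_at F (cur h) - GP I. \<pi> g < \<pi> f)"

text \<open>Newly caused flaws lie in \<Gamma>(\<open>f\<close>) and are no longer eligible, so the
  eligible set only shrinks. As \<open>f\<close> was its \<open>\<pi>\<close>-least element, all
  remaining candidates come after \<open>f\<close>.\<close>

lemma stable_inv_continue:
  assumes inv: "stable_inv h Bs I D"
    and C: "flaws_at F (cur h) - GP I \<noteq> {}"
    and f: "f = arg_min_on \<pi> (flaws_at F (cur h) - GP I)"
    and step: "\<sigma>' \<in> set_pmf (rho f (cur h))"
  shows "stable_inv (fst h, snd h @ [(f, \<sigma>')]) Bs (insert f I) D"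
proof -
  let ?C = "flaws_at F (cur h) - GP I"
  have fC: "f \<in> ?C" and least: "\<And>g. g \<in> ?C \<Longrightarrow> \<pi> f \<le> \<pi> g"
    using arg_min_if_finite(1)[OF _ C, of \<pi>] arg_min_least[OF _ C, of _ \<pi>] f by auto
  have fF: "f \<in> F" using fC by (simp add: flaws_at_def)
  have I: "I \<in> Ind sim F" "I \<subseteq> F" using inv Ind_subset by (auto simp: stable_inv_def)
  have less: "\<pi> g < \<pi> f" if "g \<in> I" for g using inv fC that by (auto simp: stable_inv_def)
  have no_sim: "\<not> sim f g \<and> \<not> sim g f" if "g \<in> I" for g
    using that fC fF I(2) sim_sym[of f g] by (auto simp: GamP_set_def Gam_def)
  have new: "flaws_at F \<sigma>' \<subseteq> (flaws_at F (cur h) - {f}) \<union> Gam F sim f"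
    using causality[of "cur h" f \<sigma>'] fC step by (auto simp: valid_step_def)
  have sub: "flaws_at F \<sigma>' - GP (insert f I) \<subseteq> ?C - {f}"
    using new by (auto simp: GamP_set_def)
  have "\<pi> g < \<pi> f'" if "g \<in> insert f I" "f' \<in> flaws_at F \<sigma>' - GP (insert f I)" for g f'
  proof -
    have f': "f' \<in> ?C" "f' \<noteq> f" using that(2) sub by auto
    then have "\<pi> f \<noteq> \<pi> f'" using inj_pi fF by (auto simp: inj_on_def flaws_at_def)
    then have "\<pi> f < \<pi> f'" using least[OF f'(1)] by simp
    then show ?thesis using that(1) less by force
  qed
  moreover have "insert f I \<in> Ind sim F" using I fF no_sim by (auto simp: Ind_def)
  moreover have "f \<in> D" using fC inv by (auto simp: stable_inv_def GamP_set_eq)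
  moreover have "flaws_at F \<sigma>' \<subseteq> D \<union> Gams F sim (insert f I)"
    using new inv by (auto simp: stable_inv_def Gams_def)
  ultimately show ?thesis
    using inv ordered_insert[OF I(2) fF less] by (simp add: stable_inv_def)
qed

text \<open>A round ends when every present flaw lies in \<open>GP I\<close>. These flaws form the
  new \<open>D\<close>, which gives the containment required between consecutive blocks.\<close>

lemma stable_inv_new_round:
  assumes inv: "stable_inv h Bs I D"
    and live: "flaws_at F (cur h) \<noteq> {}"
    and C: "flaws_at F (cur h) - GP I = {}"
    and f: "f = arg_min_on \<pi> (flaws_at F (cur h))"
    and step: "\<sigma>' \<in> set_pmf (rho f (cur h))"
  shows "stable_inv (fst h, snd h @ [(f, \<sigma>')]) (Bs @ [I]) {f} (flaws_at F (cur h))"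
proof -
  let ?C = "flaws_at F (cur h)"
  have fC: "f \<in> ?C" and least: "\<And>g. g \<in> ?C \<Longrightarrow> \<pi> f \<le> \<pi> g"
    using arg_min_if_finite(1)[OF _ live, of \<pi>] arg_min_least[OF _ live, of _ \<pi>] f by auto
  have fF: "f \<in> F" using fC by (simp add: flaws_at_def)
  have new: "flaws_at F \<sigma>' \<subseteq> (?C - {f}) \<union> Gam F sim f"
    using causality[of "cur h" f \<sigma>'] fC step by (auto simp: valid_step_def)
  have "\<pi> f < \<pi> f'" if "f' \<in> flaws_at F \<sigma>' - GP {f}" for f'
  proof -
    have f': "f' \<in> ?C" "f' \<noteq> f" using that new by (auto simp: GamP_set_def)
    then have "\<pi> f \<noteq> \<pi> f'" using inj_pi fF by (auto simp: inj_on_def flaws_at_def)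
    then show ?thesis using least[OF f'(1)] by simp
  qed
  moreover have "I \<noteq> {}" using live C by (auto simp: GamP_set_def)
  then have "layered GP (Bs @ [I])"
    using inv by (auto simp: stable_inv_def layered_append)
  moreover have "ordered {f} = [f]" using ordered_insert[of "{}" f] fF by simp
  ultimately show ?thesis
    using inv C new fC fF by (auto simp: stable_inv_def Ind_def Gams_def)
qed

lemma stable_run_inv:
  "h \<in> set_pmf (run F rho w0 (stable_strategy F sim \<pi>) k) \<Longrightarrow>
    \<exists>Bs D. stable_inv h Bs (stable_I F sim (fst h) {} (snd h)) D"
proof (induction k arbitrary: h)
  case 0
  then obtain \<sigma> where "h = (\<sigma>, [])" by auto
  \<comment> \<open>No round is complete and nothing has been addressed; \<open>D\<close> starts as
    all flaws of the initial object.\<close>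
  then have "stable_inv h [] (stable_I F sim (fst h) {} (snd h)) (flaws_at F \<sigma>)"
    by (simp add: stable_inv_def Ind_def cur_def)
  then show ?case by blast
next
  case (Suc k)
  from Suc.prems obtain h0 where h0: "h0 \<in> set_pmf (run F rho w0 (stable_strategy F sim \<pi>) k)"
    and h: "h \<in> set_pmf (if flaws_at F (cur h0) = {} then return_pmf h0
      else bind_pmf (stable_strategy F sim \<pi> h0)
        (\<lambda>f. map_pmf (\<lambda>\<sigma>'. (fst h0, snd h0 @ [(f, \<sigma>')])) (rho f (cur h0))))"
    unfolding run.simps set_bind_pmf by blast
  let ?I = "stable_I F sim (fst h0) {} (snd h0)"
  obtain Bs D where inv: "stable_inv h0 Bs ?I D" using Suc.IH[OF h0] by blast
  show ?case
  proof (cases "flaws_at F (cur h0) = {}")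
    case True
    then show ?thesis using inv h by auto
  next
    case live: False
    let ?C = "flaws_at F (cur h0) - GP ?I"
    let ?f = "if ?C \<noteq> {} then arg_min_on \<pi> ?C else arg_min_on \<pi> (flaws_at F (cur h0))"
    have "stable_strategy F sim \<pi> h0 = return_pmf ?f"
      by (simp add: stable_strategy_def Let_def)
    then have "h \<in> set_pmf (map_pmf (\<lambda>\<sigma>'. (fst h0, snd h0 @ [(?f, \<sigma>')])) (rho ?f (cur h0)))"
      using h live by (simp add: bind_return_pmf)
    then obtain \<sigma>' where \<sigma>': "\<sigma>' \<in> set_pmf (rho ?f (cur h0))" "h = (fst h0, snd h0 @ [(?f, \<sigma>')])"
      by auto
    have I': "stable_I F sim (fst h) {} (snd h) = (if ?C = {} then {?f} else insert ?f ?I)"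
      unfolding \<sigma>'(2) fst_conv snd_conv stable_I_snoc Let_def prod.collapse by (rule refl)
    show ?thesis
    proof (cases "?C = {}")
      case True
      then show ?thesis
        using stable_inv_new_round[OF inv live True, of ?f \<sigma>'] \<sigma>' I' by auto
    next
      case False
      then show ?thesis
        using stable_inv_continue[OF inv False, of ?f \<sigma>'] \<sigma>' I' by auto
    qed
  qed
qed

lemma stable_run_layered:
  assumes "h \<in> set_pmf (run F rho w0 (stable_strategy F sim \<pi>) k)"
  shows "\<exists>Bs. layered GP Bs \<and> map fst (snd h) = word Bs"
proof -
  obtain Bs I D where inv: "stable_inv h Bs I D" using stable_run_inv[OF assms] by blast
  show ?thesis
  \<comment> \<open>A nonempty unfinished round becomes the last block, as
    \<open>I \<subseteq> D\<close>; an empty one is dropped because blocks are nonempty.\<close>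
  proof (cases "I = {}")
    case True
    then show ?thesis using inv by (auto simp: stable_inv_def)
  next
    case False
    then show ?thesis using inv
      by (intro exI[of _ "Bs @ [I]"]) (auto simp: stable_inv_def layered_append)
  qed
qed

end

section \<open>Commuting kernels from SWAP\<close>

text \<open>SWAP keeps both endpoints, so for fixed \<open>\<sigma>\<close>,
  \<open>\<sigma>'\<close>, \<open>f\<close> and \<open>g\<close> it acts as an injection
  \<open>j\<close> on the middle states.\<close>

lemma swap_sum_le:
  fixes u v :: "'a::finite \<Rightarrow> real"
  assumes sw: "is_swap F sim rho SW" and "\<not> sim f g"
    and uv: "\<And>\<tau> \<tau>'. (\<sigma>, f, \<tau>, g, \<sigma>') \<in> swap_dom F sim rho \<Longrightarrow> SW (\<sigma>, f, \<tau>, g, \<sigma>') = (\<sigma>, g, \<tau>', f, \<sigma>') \<Longrightarrow>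
      u \<tau> \<le> v \<tau>'"
    and v: "\<And>\<tau>. 0 \<le> v \<tau>"
  shows "(\<Sum>\<tau> | valid_step F rho \<sigma> f \<tau> \<and> valid_step F rho \<tau> g \<sigma>'. u \<tau>)
    \<le> (\<Sum>\<tau> | valid_step F rho \<sigma> g \<tau> \<and> valid_step F rho \<tau> f \<sigma>'. v \<tau>)" (is "sum u ?A \<le> sum v ?B")
proof -
  have dom: "\<tau> \<in> ?A \<Longrightarrow> (\<sigma>, f, \<tau>, g, \<sigma>') \<in> swap_dom F sim rho" for \<tau>
    using assms(2) by (simp add: swap_dom_def)
  then have "\<forall>\<tau>\<in>?A. \<exists>\<tau>'. SW (\<sigma>, f, \<tau>, g, \<sigma>') = (\<sigma>, g, \<tau>', f, \<sigma>') \<and> \<tau>' \<in> ?B"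
    using sw unfolding is_swap_def by blast
  from bchoice[OF this] obtain j
    where j: "\<forall>\<tau>\<in>?A. SW (\<sigma>, f, \<tau>, g, \<sigma>') = (\<sigma>, g, j \<tau>, f, \<sigma>') \<and> j \<tau> \<in> ?B" ..
  have "inj_on j ?A"
  proof (rule inj_onI)
    fix x y assume x: "x \<in> ?A" and y: "y \<in> ?A" and "j x = j y"
    then have "SW (\<sigma>, f, x, g, \<sigma>') = SW (\<sigma>, f, y, g, \<sigma>')" using j by simp
    then have "(\<sigma>, f, x, g, \<sigma>') = (\<sigma>, f, y, g, \<sigma>')"
      using sw dom[OF x] dom[OF y] unfolding is_swap_def inj_on_def by blast
    then show "x = y" by simp
  qed
  moreover have "sum u ?A \<le> (\<Sum>\<tau>\<in>?A. v (j \<tau>))"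
    using j dom by (intro sum_mono uv) auto
  ultimately have "sum u ?A \<le> sum v (j ` ?A)" by (simp add: sum.reindex)
  also have "\<dots> \<le> sum v ?B" using j v by (intro sum_mono2) auto
  finally show ?thesis .
qed

text \<open>\<open>rho f \<sigma>\<close> is a distribution even when \<open>f\<close> is absent
  from \<open>\<sigma>\<close>; the value 0 restricts the matrix to valid steps.\<close>

definition step_kernel :: "'a set set \<Rightarrow> ('a set \<Rightarrow> 'a \<Rightarrow> 'a pmf) \<Rightarrow> 'a set \<Rightarrow> 'a \<Rightarrow> 'a \<Rightarrow> real" where
  "step_kernel F rho f \<sigma> \<sigma>' = (if f \<in> flaws_at F \<sigma> then pmf (rho f \<sigma>) \<sigma>' else 0)"

lemma step_kernel_eq:
  "step_kernel F rho f \<sigma> \<sigma>' = (if valid_step F rho \<sigma> f \<sigma>' then pmf (rho f \<sigma>) \<sigma>' else 0)"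
  by (auto simp: step_kernel_def valid_step_def set_pmf_iff)

text \<open>SWAP from \<open>f\<close>, \<open>g\<close> to \<open>g\<close>, \<open>f\<close> gives
  one inequality, and SWAP in the other direction its converse.\<close>

lemma step_kernel_commute:
  assumes "strongly_commutative F sim (rho :: 'a::finite set \<Rightarrow> 'a \<Rightarrow> 'a pmf)" "\<not> sim f g" "\<not> sim g f"
  shows "(\<Sum>\<tau>\<in>UNIV. step_kernel F rho f \<sigma> \<tau> * step_kernel F rho g \<tau> \<sigma>')
    = (\<Sum>\<tau>\<in>UNIV. step_kernel F rho g \<sigma> \<tau> * step_kernel F rho f \<tau> \<sigma>')"
proof -
  obtain SW where sw: "is_swap F sim rho SW" "\<forall>\<sigma>1 f \<sigma>2 g \<sigma>3 \<sigma>2'.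
        (\<sigma>1, f, \<sigma>2, g, \<sigma>3) \<in> swap_dom F sim rho \<longrightarrow>
        SW (\<sigma>1, f, \<sigma>2, g, \<sigma>3) = (\<sigma>1, g, \<sigma>2', f, \<sigma>3) \<longrightarrow>
        pmf (rho f \<sigma>1) \<sigma>2 * pmf (rho g \<sigma>2) \<sigma>3 = pmf (rho g \<sigma>1) \<sigma>2' * pmf (rho f \<sigma>2') \<sigma>3"
    using assms(1) unfolding strongly_commutative_def by blast
  have eq: "(\<Sum>\<tau>\<in>UNIV. step_kernel F rho f \<sigma> \<tau> * step_kernel F rho g \<tau> \<sigma>')
      = (\<Sum>\<tau> | valid_step F rho \<sigma> f \<tau> \<and> valid_step F rho \<tau> g \<sigma>'. pmf (rho f \<sigma>) \<tau> * pmf (rho g \<tau>) \<sigma>')" for f g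
    by (rule sum.mono_neutral_cong_right) (auto simp: step_kernel_eq)
  have le: "(\<Sum>\<tau>\<in>UNIV. step_kernel F rho f \<sigma> \<tau> * step_kernel F rho g \<tau> \<sigma>')
      \<le> (\<Sum>\<tau>\<in>UNIV. step_kernel F rho g \<sigma> \<tau> * step_kernel F rho f \<tau> \<sigma>')" if "\<not> sim f g" for f g
    unfolding eq using sw(2) by (intro swap_sum_le[OF sw(1) that]) auto
  show ?thesis using le assms(2,3) by (simp add: antisym)
qed

text \<open>The ratios of \<open>\<omega>\<close> telescope along a walk, so the weight depends only
  on the endpoints and the multiset of flaws. Commutation then amounts to equal numbers of two-step
  walks.\<close>

definition ratio_kernel ::
  "'a set set \<Rightarrow> ('a set \<Rightarrow> 'a \<Rightarrow> 'a pmf) \<Rightarrow> 'a pmf \<Rightarrow> ('a set \<Rightarrow> real) \<Rightarrow> 'a set \<Rightarrow> 'a \<Rightarrow> 'a \<Rightarrow> real" where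
  "ratio_kernel F rho \<omega> lam f \<sigma> \<sigma>' =
    (if valid_step F rho \<sigma> f \<sigma>' then lam f * pmf \<omega> \<sigma>' / pmf \<omega> \<sigma> else 0)"

lemma ratio_kernel_commute:
  fixes rho :: "'a::finite set \<Rightarrow> 'a \<Rightarrow> 'a pmf"
  assumes "weakly_commutative F sim rho" "\<not> sim f g" "\<not> sim g f"
    and "\<And>\<sigma>. 0 < pmf \<omega> \<sigma>" "0 \<le> lam f" "0 \<le> lam g"
  shows "(\<Sum>\<tau>\<in>UNIV. ratio_kernel F rho \<omega> lam f \<sigma> \<tau> * ratio_kernel F rho \<omega> lam g \<tau> \<sigma>')
    = (\<Sum>\<tau>\<in>UNIV. ratio_kernel F rho \<omega> lam g \<sigma> \<tau> * ratio_kernel F rho \<omega> lam f \<tau> \<sigma>')"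
proof -
  obtain SW where sw: "is_swap F sim rho SW" using assms(1) unfolding weakly_commutative_def by blast
  have ne: "pmf \<omega> \<tau> \<noteq> 0" for \<tau> using assms(4)[of \<tau>] by simp
  have eq: "(\<Sum>\<tau>\<in>UNIV. ratio_kernel F rho \<omega> lam f \<sigma> \<tau> * ratio_kernel F rho \<omega> lam g \<tau> \<sigma>')
      = (\<Sum>\<tau> | valid_step F rho \<sigma> f \<tau> \<and> valid_step F rho \<tau> g \<sigma>'. lam f * lam g * pmf \<omega> \<sigma>' / pmf \<omega> \<sigma>)" for f g
    by (rule sum.mono_neutral_cong_right) (auto simp: ratio_kernel_def ne)
  have le: "(\<Sum>\<tau>\<in>UNIV. ratio_kernel F rho \<omega> lam f \<sigma> \<tau> * ratio_kernel F rho \<omega> lam g \<tau> \<sigma>')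
      \<le> (\<Sum>\<tau>\<in>UNIV. ratio_kernel F rho \<omega> lam g \<sigma> \<tau> * ratio_kernel F rho \<omega> lam f \<tau> \<sigma>')"
    if "\<not> sim f g" "0 \<le> lam f" "0 \<le> lam g" for f g
    unfolding eq using that by (intro swap_sum_le[OF sw that(1)]) (auto simp: mult.commute)
  show ?thesis using le assms(2,3,5,6) by (simp add: antisym)
qed

lemma lambda_ok_bounds:
  fixes rho :: "'a::finite set \<Rightarrow> 'a \<Rightarrow> 'a pmf"
  assumes ok: "lambda_ok F rho \<omega> lam" and f: "f \<in> F" and pos: "\<And>\<sigma>. 0 < pmf \<omega> \<sigma>"
  shows "0 \<le> lam f"
    and "(\<Sum>\<sigma>\<in>UNIV. pmf \<omega> \<sigma> * step_kernel F rho f \<sigma> \<sigma>') \<le> lam f * pmf \<omega> \<sigma>'"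
    and "f \<in> flaws_at F \<sigma> \<Longrightarrow> pmf (rho f \<sigma>) \<sigma>' * pmf \<omega> \<sigma> \<le> lam f * pmf \<omega> \<sigma>'"
proof -
  let ?A = "{\<sigma>\<in>f. \<sigma>' \<in> set_pmf (rho f \<sigma>)}"
  have le: "(\<Sum>\<sigma>\<in>?A. pmf (rho f \<sigma>) \<sigma>' * pmf \<omega> \<sigma> / pmf \<omega> \<sigma>') \<le> lam f"
    using ok f by (simp add: lambda_ok_def)
  show "0 \<le> lam f" by (rule order_trans[OF _ le]) (auto intro!: sum_nonneg)
  have "(\<Sum>\<sigma>\<in>UNIV. pmf \<omega> \<sigma> * step_kernel F rho f \<sigma> \<sigma>') = (\<Sum>\<sigma>\<in>?A. pmf (rho f \<sigma>) \<sigma>' * pmf \<omega> \<sigma>)"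
    using f by (intro sum.mono_neutral_cong_right) (auto simp: step_kernel_def flaws_at_def set_pmf_iff)
  also have "\<dots> = (\<Sum>\<sigma>\<in>?A. pmf (rho f \<sigma>) \<sigma>' * pmf \<omega> \<sigma> / pmf \<omega> \<sigma>') * pmf \<omega> \<sigma>'"
    using pos[of \<sigma>'] by (simp add: sum_divide_distrib[symmetric])
  also have "\<dots> \<le> lam f * pmf \<omega> \<sigma>'" by (intro mult_right_mono le) simp
  finally show sum: "(\<Sum>\<sigma>\<in>UNIV. pmf \<omega> \<sigma> * step_kernel F rho f \<sigma> \<sigma>') \<le> lam f * pmf \<omega> \<sigma>'" .
  assume fs: "f \<in> flaws_at F \<sigma>"
  have "pmf \<omega> \<sigma> * step_kernel F rho f \<sigma> \<sigma>' \<le> (\<Sum>\<sigma>\<in>UNIV. pmf \<omega> \<sigma> * step_kernel F rho f \<sigma> \<sigma>')"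
    by (rule member_le_sum) (auto simp: step_kernel_def)
  then show "pmf (rho f \<sigma>) \<sigma>' * pmf \<omega> \<sigma> \<le> lam f * pmf \<omega> \<sigma>'"
    using sum fs by (simp add: step_kernel_def mult.commute)
qed

lemma (in flaw_system) step_flaw_kernel:
  assumes "lambda_ok F rho \<omega> lam" "\<And>\<sigma>. 0 < pmf \<omega> \<sigma>"
  shows "flaw_kernel F sim \<pi> rho \<omega> lam (step_kernel F rho)"
proof
  fix f \<sigma> \<sigma>'
  show "0 < pmf \<omega> \<sigma>" by fact
  show "f \<in> F \<Longrightarrow> 0 \<le> lam f"
    "f \<in> F \<Longrightarrow> (\<Sum>\<sigma>\<in>UNIV. pmf \<omega> \<sigma> * step_kernel F rho f \<sigma> \<sigma>') \<le> lam f * pmf \<omega> \<sigma>'"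
    using lambda_ok_bounds(1,2)[OF assms(1) _ assms(2)] by auto
qed (auto simp: step_kernel_def valid_step_def set_pmf_iff split: if_splits)

text \<open>Domination of \<open>rho\<close> holds because each single term of the sum in condition
  (i) is at most \<open>lam f\<close>. Atomicity leaves at most one predecessor of
  \<open>\<sigma>'\<close>, so the column sum against \<open>\<omega>\<close> has at most one term,
  equal to \<open>lam f * pmf \<omega> \<sigma>'\<close>.\<close>

lemma (in flaw_system) ratio_flaw_kernel:
  assumes ok: "lambda_ok F rho \<omega> lam" and pos: "\<And>\<sigma>. 0 < pmf \<omega> \<sigma>" and atomic: "atomic F rho"
  shows "flaw_kernel F sim \<pi> rho \<omega> lam (ratio_kernel F rho \<omega> lam)"
proof
  fix f \<sigma> \<sigma>'
  show "0 < pmf \<omega> \<sigma>" by (rule pos)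
  have ne: "pmf \<omega> \<tau> \<noteq> 0" for \<tau> using pos[of \<tau>] by simp
  note lam = lambda_ok_bounds(1)[OF ok _ pos]
  show "f \<in> F \<Longrightarrow> 0 \<le> lam f" by (rule lam)
  show "0 \<le> ratio_kernel F rho \<omega> lam f \<sigma> \<sigma>'"
    using lam[of f] by (auto simp: ratio_kernel_def valid_step_def flaws_at_def)
  show "ratio_kernel F rho \<omega> lam f \<sigma> \<sigma>' \<noteq> 0 \<Longrightarrow> valid_step F rho \<sigma> f \<sigma>'"
    by (simp add: ratio_kernel_def split: if_splits)
  show "pmf (rho f \<sigma>) \<sigma>' \<le> ratio_kernel F rho \<omega> lam f \<sigma> \<sigma>'" if f: "f \<in> flaws_at F \<sigma>"
  proof (cases "\<sigma>' \<in> set_pmf (rho f \<sigma>)")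
    case True
    have "f \<in> F" using f by (simp add: flaws_at_def)
    from lambda_ok_bounds(3)[OF ok this pos f] show ?thesis
      using True f pos[of \<sigma>] by (simp add: ratio_kernel_def valid_step_def pos_le_divide_eq)
  next
    case False
    then show ?thesis by (simp add: ratio_kernel_def valid_step_def set_pmf_iff)
  qed
  show "(\<Sum>\<sigma>\<in>UNIV. pmf \<omega> \<sigma> * ratio_kernel F rho \<omega> lam f \<sigma> \<sigma>') \<le> lam f * pmf \<omega> \<sigma>'" if f: "f \<in> F"
  proof -
    let ?V = "{\<sigma>. valid_step F rho \<sigma> f \<sigma>'}"
    have "?V = {} \<or> (\<exists>\<sigma>0. ?V = {\<sigma>0})"
      using atomic f unfolding atomic_def by blast
    then have card: "card ?V \<le> 1" by auto
    have "(\<Sum>\<sigma>\<in>UNIV. pmf \<omega> \<sigma> * ratio_kernel F rho \<omega> lam f \<sigma> \<sigma>') = (\<Sum>\<sigma>\<in>?V. lam f * pmf \<omega> \<sigma>')"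
      by (rule sum.mono_neutral_cong_right) (auto simp: ratio_kernel_def ne)
    also have "\<dots> = real (card ?V) * (lam f * pmf \<omega> \<sigma>')" by simp
    also have "\<dots> \<le> 1 * (lam f * pmf \<omega> \<sigma>')"
      using card lam[OF f] by (intro mult_right_mono) auto
    finally show ?thesis by simp
  qed
qed

subsection \<open>The local lemma conditions\<close>

text \<open>The map \<open>R \<mapsto> (R \<inter> A, R - A)\<close> embeds
  \<open>Ind sim (A \<union> B)\<close> into the product and is multiplicative for the weights; the
  pairs missed are nonnegative.\<close>

lemma sum_Ind_union_le:
  fixes mu :: "'a::finite set \<Rightarrow> real"
  assumes "\<And>f. f \<in> A \<union> B \<Longrightarrow> 0 \<le> mu f"
  shows "(\<Sum>R\<in>Ind sim (A \<union> B). \<Prod>f\<in>R. mu f)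
    \<le> (\<Sum>R\<in>Ind sim A. \<Prod>f\<in>R. mu f) * (\<Sum>R\<in>Ind sim B. \<Prod>f\<in>R. mu f)"
proof -
  let ?j = "\<lambda>R. (R \<inter> A, R - A)"
  let ?u = "\<lambda>(R, R'). (\<Prod>f\<in>R. mu f) * (\<Prod>f\<in>R'. mu f)"
  have inj: "inj_on ?j (Ind sim (A \<union> B))" by (rule inj_onI) auto
  have "(\<Sum>R\<in>Ind sim (A \<union> B). \<Prod>f\<in>R. mu f) = (\<Sum>R\<in>Ind sim (A \<union> B). ?u (?j R))"
  proof (rule sum.cong[OF refl])
    fix R
    have "(\<Prod>f\<in>(R \<inter> A) \<union> (R - A). mu f) = (\<Prod>f\<in>R \<inter> A. mu f) * (\<Prod>f\<in>R - A. mu f)"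
      by (rule prod.union_disjoint) auto
    then show "(\<Prod>f\<in>R. mu f) = ?u (?j R)" by (simp add: Int_Diff_Un)
  qed
  also have "\<dots> = sum ?u (?j ` Ind sim (A \<union> B))"
    by (simp add: sum.reindex[OF inj])
  also have "\<dots> \<le> sum ?u (Ind sim A \<times> Ind sim B)"
  proof (rule sum_mono2)
    show "?j ` Ind sim (A \<union> B) \<subseteq> Ind sim A \<times> Ind sim B" by (auto simp: Ind_def)
    show "0 \<le> ?u b" if "b \<in> Ind sim A \<times> Ind sim B - ?j ` Ind sim (A \<union> B)" for b
    proof -
      from that have "fst b \<subseteq> A" "snd b \<subseteq> B" by (auto simp: Ind_def)
      then show ?thesis using assms
        by (auto simp: case_prod_unfold subset_iff intro!: mult_nonneg_nonneg prod_nonneg)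
    qed
  qed simp
  also have "\<dots> = (\<Sum>R\<in>Ind sim A. \<Prod>f\<in>R. mu f) * (\<Sum>R\<in>Ind sim B. \<Prod>f\<in>R. mu f)"
    by (simp add: sum_product sum.cartesian_product)
  finally show ?thesis .
qed

text \<open>The condition for single flaws extends to sets one flaw at a time, since \<Gamma> of a
  set is the union over its members and the sums over independent sets are
  submultiplicative.\<close>

lemma alg_LLL_block:
  fixes mu :: "'a::finite set \<Rightarrow> real"
  assumes mu: "\<And>f. f \<in> F \<Longrightarrow> 0 < mu f" and lam: "\<And>f. f \<in> F \<Longrightarrow> 0 \<le> lam f"
    and LLL: "\<And>f. f \<in> F \<Longrightarrow> lam f / mu f * (\<Sum>S\<in>Ind sim (Gam F sim f). \<Prod>g\<in>S. mu g) \<le> \<theta>"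
    and "0 \<le> \<theta>" "R \<subseteq> F"
  shows "(\<Prod>f\<in>R. lam f) * (\<Sum>R'\<in>Ind sim (Gams F sim R). \<Prod>f\<in>R'. mu f) \<le> \<theta> ^ card R * (\<Prod>f\<in>R. mu f)"
proof -
  let ?Z = "\<lambda>A. \<Sum>R'\<in>Ind sim A. \<Prod>f\<in>R'. mu f"
  have Z_nonneg: "0 \<le> ?Z A" if "A \<subseteq> F" for A
    using that mu by (intro sum_nonneg prod_nonneg) (auto simp: Ind_def intro: less_imp_le)
  have "finite R" by simp
  then show ?thesis using \<open>R \<subseteq> F\<close>
  proof (induction R rule: finite_induct)
    case empty
    have "Ind sim (Gams F sim {}) = {{}}" by (auto simp: Gams_def Ind_def)
    then show ?case by simp
  next
    case (insert f R)
    have G: "Gam F sim f \<subseteq> F" "Gams F sim R \<subseteq> F" by (auto simp: Gams_def Gam_def)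
    have f: "lam f * ?Z (Gam F sim f) \<le> \<theta> * mu f"
      using LLL[of f] mu[of f] insert.prems by (simp add: field_simps)
    have "(\<Prod>f\<in>insert f R. lam f) * ?Z (Gams F sim (insert f R))
        \<le> (\<Prod>f\<in>insert f R. lam f) * (?Z (Gam F sim f) * ?Z (Gams F sim R))"
    proof (rule mult_left_mono)
      have eq: "Gams F sim (insert f R) = Gam F sim f \<union> Gams F sim R" by (simp add: Gams_def)
      have "0 \<le> mu g" if "g \<in> Gam F sim f \<union> Gams F sim R" for g
        using that G mu[of g] by (auto intro: less_imp_le)
      then show "?Z (Gams F sim (insert f R)) \<le> ?Z (Gam F sim f) * ?Z (Gams F sim R)"
        unfolding eq by (rule sum_Ind_union_le)
      show "0 \<le> (\<Prod>f\<in>insert f R. lam f)" using insert.prems lam by (intro prod_nonneg) auto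
    qed
    also have "\<dots> = (lam f * ?Z (Gam F sim f)) * ((\<Prod>f\<in>R. lam f) * ?Z (Gams F sim R))"
      using insert.hyps by simp
    also have "\<dots> \<le> (\<theta> * mu f) * (\<theta> ^ card R * (\<Prod>f\<in>R. mu f))"
    proof (rule mult_mono[OF f])
      show "(\<Prod>f\<in>R. lam f) * ?Z (Gams F sim R) \<le> \<theta> ^ card R * (\<Prod>f\<in>R. mu f)"
        using insert by auto
      show "0 \<le> \<theta> * mu f" using \<open>0 \<le> \<theta>\<close> mu[of f] insert.prems by simp
      show "0 \<le> (\<Prod>f\<in>R. lam f) * ?Z (Gams F sim R)"
        using insert.prems lam G by (intro mult_nonneg_nonneg prod_nonneg Z_nonneg) auto
    qed
    also have "\<dots> = \<theta> ^ card (insert f R) * (\<Prod>f\<in>insert f R. mu f)"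
      using insert.hyps by simp
    finally show ?case .
  qed
qed

section \<open>Independence polynomials and Shearer's condition\<close>

text \<open>The independence polynomial, at \<open>-p\<close>, of the graph induced on
  \<open>F - A\<close>.\<close>

definition indep_poly :: "'a set set \<Rightarrow> ('a set \<Rightarrow> 'a set \<Rightarrow> bool) \<Rightarrow> ('a set \<Rightarrow> real) \<Rightarrow> 'a set set \<Rightarrow> real" where
  "indep_poly F sim p A = (\<Sum>I | I \<in> Ind sim F \<and> I \<inter> A = {}. (- 1) ^ card I * (\<Prod>f\<in>I. p f))"

text \<open>Up to the sign of \<open>card I\<close> this is the expansion of
  \<open>(1 - 1) ^ card X\<close>.\<close>

lemma sum_Pow_alternating:
  assumes "finite I" "X \<subseteq> I"
  shows "(\<Sum>R\<in>Pow X. (- 1) ^ (card I - card R)) = (if X = {} then (- 1) ^ card I else (0::real))"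
proof -
  have fin: "finite X" using assms finite_subset by blast
  have "(\<Sum>R\<in>Pow X. (- 1) ^ (card I - card R)) = (\<Sum>R\<in>Pow X. (- 1) ^ card I * (- 1 :: real) ^ card R)"
  proof (rule sum.cong[OF refl])
    fix R assume "R \<in> Pow X"
    then have "card R \<le> card I" using assms by (intro card_mono) auto
    then show "(- 1 :: real) ^ (card I - card R) = (- 1) ^ card I * (- 1) ^ card R"
      by (simp add: power_diff_conv_inverse)
  qed
  also have "\<dots> = (- 1) ^ card I * (\<Sum>R\<in>Pow X. (\<Prod>x\<in>R. - 1) * (\<Prod>x\<in>X - R. 1))"
    by (simp add: sum_distrib_left)
  also have "(\<Sum>R\<in>Pow X. (\<Prod>x\<in>R. - 1) * (\<Prod>x\<in>X - R. 1)) = (\<Prod>x\<in>X. - 1 + (1::real))"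
    using fin by (rule prod_add[symmetric])
  finally show ?thesis using fin by (simp add: power_0_left)
qed

text \<open>Inclusion-exclusion: after exchanging the sums, an independent set \<open>I\<close> is
  met with alternating signs by all subsets \<open>R\<close> of \<open>I \<inter> A\<close>, and
  survives only if that intersection is empty.\<close>

lemma sum_qS_eq_indep_poly:
  fixes p :: "'a::finite set \<Rightarrow> real"
  assumes "A \<subseteq> F"
  shows "(\<Sum>R\<in>Ind sim A. qS F sim p R) = indep_poly F sim p A"
proof -
  let ?t = "\<lambda>I R. (- 1) ^ (card I - card R) * (\<Prod>f\<in>I. p f)"
  have "(\<Sum>R\<in>Ind sim A. qS F sim p R) = (\<Sum>R\<in>Ind sim A. \<Sum>I\<in>Ind sim F. if R \<subseteq> I then ?t I R else 0)"
    by (simp add: qS_def sum.inter_filter)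
  also have "\<dots> = (\<Sum>I\<in>Ind sim F. \<Sum>R\<in>Ind sim A. if R \<subseteq> I then ?t I R else 0)"
    by (rule sum.swap)
  also have "\<dots> = (\<Sum>I\<in>Ind sim F. if I \<inter> A = {} then (- 1) ^ card I * (\<Prod>f\<in>I. p f) else 0)"
  proof (rule sum.cong[OF refl])
    fix I assume I: "I \<in> Ind sim F"
    have "(\<Sum>R\<in>Ind sim A. if R \<subseteq> I then ?t I R else 0) = (\<Sum>R\<in>{R \<in> Ind sim A. R \<subseteq> I}. ?t I R)"
      by (simp add: sum.inter_filter)
    also have "{R \<in> Ind sim A. R \<subseteq> I} = Pow (I \<inter> A)" using I by (auto simp: Ind_def)
    also have "(\<Sum>R\<in>Pow (I \<inter> A). ?t I R) = (\<Sum>R\<in>Pow (I \<inter> A). (- 1) ^ (card I - card R)) * (\<Prod>f\<in>I. p f)"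
      by (rule sum_distrib_right[symmetric])
    also have "\<dots> = (if I \<inter> A = {} then (- 1) ^ card I * (\<Prod>f\<in>I. p f) else 0)"
      by (subst sum_Pow_alternating) auto
    finally show "(\<Sum>R\<in>Ind sim A. if R \<subseteq> I then ?t I R else 0)
      = (if I \<inter> A = {} then (- 1) ^ card I * (\<Prod>f\<in>I. p f) else 0)" .
  qed
  also have "\<dots> = indep_poly F sim p A"
    by (simp add: indep_poly_def sum.inter_filter)
  finally show ?thesis .
qed

text \<open>Independent supersets of \<open>R\<close> are exactly the sets
  \<open>R \<union> J\<close> with \<open>J\<close> independent and disjoint from
  \<open>GP R\<close>.\<close>

lemma (in flaw_order) qS_eq_indep_poly:
  assumes R: "R \<in> Ind sim F"
  shows "qS F sim p R = (\<Prod>f\<in>R. p f) * indep_poly F sim p (GP R)"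
proof -
  have "qS F sim p R = (\<Sum>J | J \<in> Ind sim F \<and> J \<inter> GP R = {}. (- 1) ^ card J * ((\<Prod>f\<in>R. p f) * (\<Prod>f\<in>J. p f)))"
    unfolding qS_def
  proof (rule sum.reindex_bij_witness[where i = "\<lambda>J. R \<union> J" and j = "\<lambda>I. I - R"])
    fix I assume I: "I \<in> {I \<in> Ind sim F. R \<subseteq> I}"
    then show "R \<union> (I - R) = I" by auto
    have "g \<noteq> f \<and> \<not> sim f g" if "g \<in> I - R" "f \<in> R" for f g
      using I that by (auto simp: Ind_def)
    then have "(I - R) \<inter> GP R = {}" by (fastforce simp: GamP_set_def Gam_def)
    moreover have "I - R \<in> Ind sim F" using I by (auto simp: Ind_def)
    ultimately show "I - R \<in> {J. J \<in> Ind sim F \<and> J \<inter> GP R = {}}" by simp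
    have "(\<Prod>f\<in>R \<union> (I - R). p f) = (\<Prod>f\<in>R. p f) * (\<Prod>f\<in>I - R. p f)"
      by (rule prod.union_disjoint) auto
    moreover have "R \<union> (I - R) = I" using I by auto
    moreover have "card (I - R) = card I - card R" using I by (intro card_Diff_subset) auto
    ultimately show "(- 1) ^ card (I - R) * ((\<Prod>f\<in>R. p f) * (\<Prod>f\<in>I - R. p f))
        = (- 1) ^ (card I - card R) * (\<Prod>f\<in>I. p f)" by simp
  next
    fix J assume J: "J \<in> {J. J \<in> Ind sim F \<and> J \<inter> GP R = {}}"
    then have "J \<inter> R = {}" by (auto simp: GamP_set_def)
    then show "R \<union> J - R = J" by auto
    have "\<not> sim f g \<and> \<not> sim g f" if "f \<in> R" "g \<in> J" for f g
    proof -
      have "f \<in> F" "g \<in> F" using that R J by (auto simp: Ind_def)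
      moreover have "g \<notin> Gam F sim f" using that J by (auto simp: GamP_set_def)
      ultimately show ?thesis using sim_sym[of f g] by (auto simp: Gam_def)
    qed
    then show "R \<union> J \<in> {I \<in> Ind sim F. R \<subseteq> I}" using R J by (auto simp: Ind_def)
  qed
  also have "\<dots> = (\<Prod>f\<in>R. p f) * indep_poly F sim p (GP R)"
    by (simp add: indep_poly_def sum_distrib_left mult_ac)
  finally show ?thesis .
qed

text \<open>Summed over \<open>Ind sim (GP R)\<close> with weights \<open>\<theta> * p f\<close> the
  two preceding identities give equality. Passing to \<open>Gams F sim R\<close> drops nonnegative
  terms, and \<open>lam f \<le> \<theta> * p f\<close> does the rest.\<close>

lemma (in flaw_order) shearer_block:
  assumes q: "\<And>S. S \<subseteq> F \<Longrightarrow> 0 \<le> qS F sim p S"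
    and lam: "\<And>f. f \<in> F \<Longrightarrow> 0 \<le> lam f" "\<And>f. f \<in> F \<Longrightarrow> lam f \<le> \<theta> * p f"
    and \<theta>: "0 < \<theta>" and R: "R \<in> Ind sim F"
  shows "(\<Prod>f\<in>R. lam f) * (\<Sum>R'\<in>Ind sim (Gams F sim R). qS F sim p R') \<le> \<theta> ^ card R * qS F sim p R"
proof -
  have RF: "R \<subseteq> F" using R by (rule Ind_subset)
  have GF: "Gams F sim R \<subseteq> F" "GP R \<subseteq> F" using RF by (auto simp: Gams_def Gam_def GamP_set_def)
  \<comment> \<open>Nonnegativity of \<open>p\<close> comes from
    \<open>0 \<le> lam f \<le> \<theta> * p f\<close>.\<close>
  have p: "0 \<le> p f" if "f \<in> F" for f
    using lam(1,2)[OF that] \<theta> by (metis order_trans zero_le_mult_iff less_le_not_le)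
  have "(\<Prod>f\<in>R. lam f) * (\<Sum>R'\<in>Ind sim (Gams F sim R). qS F sim p R')
      \<le> (\<Prod>f\<in>R. \<theta> * p f) * (\<Sum>R'\<in>Ind sim (GP R). qS F sim p R')"
  proof (rule mult_mono)
    show "(\<Prod>f\<in>R. lam f) \<le> (\<Prod>f\<in>R. \<theta> * p f)" using RF lam by (intro prod_mono) auto
    show "(\<Sum>R'\<in>Ind sim (Gams F sim R). qS F sim p R') \<le> (\<Sum>R'\<in>Ind sim (GP R). qS F sim p R')"
    proof (rule sum_mono2)
      show "Ind sim (Gams F sim R) \<subseteq> Ind sim (GP R)" by (rule Ind_mono) (simp add: GamP_set_eq)
      show "0 \<le> qS F sim p R'" if "R' \<in> Ind sim (GP R) - Ind sim (Gams F sim R)" for R'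
        using that GF by (intro q) (auto simp: Ind_def)
    qed simp
    show "0 \<le> (\<Prod>f\<in>R. \<theta> * p f)" using RF p \<theta> by (intro prod_nonneg) auto
    show "0 \<le> (\<Sum>R'\<in>Ind sim (Gams F sim R). qS F sim p R')"
      using GF by (intro sum_nonneg q) (auto simp: Ind_def)
  qed
  also have "\<dots> = \<theta> ^ card R * qS F sim p R"
    using sum_qS_eq_indep_poly[OF GF(2), of sim p] qS_eq_indep_poly[OF R, of p]
    by (simp add: prod.distrib)
  finally show ?thesis .
qed

section \<open>The tail bound for the number of steps\<close>

theorem theorem1:
  fixes F :: "'a::finite set set"
    and sim :: "'a set \<Rightarrow> 'a set \<Rightarrow> bool"
    and rho :: "'a set \<Rightarrow> 'a \<Rightarrow> 'a pmf"
    and \<omega> w0 :: "'a pmf"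
    and S :: "'a hist \<Rightarrow> 'a set pmf"
    and \<theta> T r :: real
    and muR :: "'a set set \<Rightarrow> real"
    and Iinit :: "'a set set set"
    and n :: nat
  assumes setting: "flaw_setting F sim rho \<omega>"
    and theta: "0 < \<theta>" "\<theta> < 1"
    and cond: "(\<exists>lam mu. alg_LLL F sim rho \<omega> \<theta> lam mu \<and> muR = (\<lambda>R. \<Prod>f\<in>R. mu f))
             \<or> (\<exists>lam p. shearer F sim rho \<omega> \<theta> lam p \<and> muR = (\<lambda>R. qS F sim p R / qS F sim p {}))"
    and strat: "valid_strategy F S"
    and cases:
      "(\<exists>\<pi>. bij_betw \<pi> F {..<card F} \<and> S = stable_strategy F sim \<pi>
             \<and> Iinit = (\<Union>\<sigma>\<in>set_pmf w0. Ind sim (flaws_at F \<sigma>)))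
       \<or> (weakly_commutative F sim rho \<and> atomic F rho
             \<and> Iinit = (\<Union>\<sigma>\<in>set_pmf w0. Ind sim (flaws_at F \<sigma>)))
       \<or> (strongly_commutative F sim rho \<and> Iinit = Ind sim F)"
    and T: "T = (ln (gamma_init \<omega> w0) + ln (\<Sum>R\<in>Iinit. muR R)) / ln (1 / \<theta>)"
    and n: "T + r \<le> real n"
  shows "measure_pmf.prob (run F rho w0 S n)
           {h. flaws_at F (cur h) = {} \<and> real (length (snd h)) < T + r} \<ge> 1 - \<theta> powr r"
proof -
  have pos: "\<And>\<sigma>. 0 < pmf \<omega> \<sigma>"
    and sim_sym: "\<And>f g. f \<in> F \<Longrightarrow> g \<in> F \<Longrightarrow> sim f g \<longleftrightarrow> sim g f"
    and causal: "\<And>\<sigma> f \<sigma>'. valid_step F rho \<sigma> f \<sigma>' \<Longrightarrow>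
      flaws_at F \<sigma>' \<subseteq> (flaws_at F \<sigma> - {f}) \<union> Gam F sim f"
    using setting by (auto simp: flaw_setting_def)
  \<comment> \<open>In the commutative cases any injective numbering of \<open>F\<close> serves to
    order the blocks.\<close>
  obtain \<pi> :: "'a set \<Rightarrow> nat" where inj: "inj_on \<pi> F"
    and alt: "S = stable_strategy F sim \<pi> \<or> weakly_commutative F sim rho \<and> atomic F rho
      \<or> strongly_commutative F sim rho"
  proof -
    obtain \<pi>0 :: "'a set \<Rightarrow> nat" where "inj_on \<pi>0 F"
      using finite_imp_inj_to_nat_seg[of F] by auto
    then show ?thesis using cases that by (auto simp: bij_betw_def)
  qed
  interpret flaw_system F sim \<pi> rho
    using sim_sym inj causal by unfold_locales
  have flaws_F: "flaws_at F \<sigma> \<subseteq> F" for \<sigma> by (auto simp: flaws_at_def)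
  have J: "Iinit \<subseteq> Ind sim F" "\<And>\<sigma>. \<sigma> \<in> set_pmf w0 \<Longrightarrow> Ind sim (flaws_at F \<sigma>) \<subseteq> Iinit"
    using cases Ind_mono[OF flaws_F] by auto
  \<comment> \<open>Both local lemma conditions are reduced to one inequality per block. In
    Shearer's case it is divided by \<open>qS F sim p {}\<close>, which also gives
    \<open>muR {} = 1\<close>.\<close>
  have "\<exists>lam. lambda_ok F rho \<omega> lam \<and> muR {} = 1 \<and> (\<forall>R\<in>Ind sim F. 0 \<le> muR R) \<and>
    (\<forall>R\<in>Ind sim F. (\<Prod>f\<in>R. lam f) * (\<Sum>R'\<in>Ind sim (Gams F sim R). muR R') \<le> \<theta> ^ card R * muR R)"
    using cond
  proof (elim disjE exE conjE)
    fix lam mu assume LLL: "alg_LLL F sim rho \<omega> \<theta> lam mu" and muR: "muR = (\<lambda>R. \<Prod>f\<in>R. mu f)"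
    have ok: "lambda_ok F rho \<omega> lam" using LLL by (simp add: alg_LLL_def)
    have "0 \<le> muR R" if "R \<in> Ind sim F" for R
      using Ind_subset[OF that] LLL unfolding muR alg_LLL_def
      by (intro prod_nonneg) (auto intro: less_imp_le)
    moreover have "(\<Prod>f\<in>R. lam f) * (\<Sum>R'\<in>Ind sim (Gams F sim R). muR R') \<le> \<theta> ^ card R * muR R"
      if "R \<in> Ind sim F" for R
      unfolding muR using LLL theta(1) Ind_subset[OF that] lambda_ok_bounds(1)[OF ok _ pos]
      by (intro alg_LLL_block) (auto simp: alg_LLL_def)
    ultimately show ?thesis using ok muR by auto
  next
    fix lam p assume sh: "shearer F sim rho \<omega> \<theta> lam p"
      and muR: "muR = (\<lambda>R. qS F sim p R / qS F sim p {})"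
    have ok: "lambda_ok F rho \<omega> lam" and q0: "0 < qS F sim p {}"
      and q: "\<And>S. S \<subseteq> F \<Longrightarrow> 0 \<le> qS F sim p S"
      using sh by (auto simp: shearer_def shearer_vec_def)
    have "0 \<le> muR R" if "R \<in> Ind sim F" for R
      using q[OF Ind_subset[OF that]] q0 by (simp add: muR)
    moreover have "(\<Prod>f\<in>R. lam f) * (\<Sum>R'\<in>Ind sim (Gams F sim R). muR R') \<le> \<theta> ^ card R * muR R"
      if "R \<in> Ind sim F" for R
    proof -
      have "(\<Prod>f\<in>R. lam f) * (\<Sum>R'\<in>Ind sim (Gams F sim R). qS F sim p R') \<le> \<theta> ^ card R * qS F sim p R"
        using sh q theta(1) that lambda_ok_bounds(1)[OF ok _ pos]
        by (intro shearer_block) (auto simp: shearer_def)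
      then show ?thesis
        using q0 by (simp add: muR sum_divide_distrib[symmetric] divide_right_mono)
    qed
    ultimately show ?thesis using ok muR q0 by auto
  qed
  then obtain lam where ok: "lambda_ok F rho \<omega> lam" and mu: "muR {} = 1"
    "\<And>R. R \<in> Ind sim F \<Longrightarrow> 0 \<le> muR R"
    "\<And>R. R \<in> Ind sim F \<Longrightarrow>
      (\<Prod>f\<in>R. lam f) * (\<Sum>R'\<in>Ind sim (Gams F sim R). muR R') \<le> \<theta> ^ card R * muR R"
    by blast

  define \<gamma> where "\<gamma> = gamma_init \<omega> w0"
  have \<gamma>_ge: "pmf w0 \<sigma> / pmf \<omega> \<sigma> \<le> \<gamma>" for \<sigma>
    unfolding \<gamma>_def gamma_init_def by (intro Max_ge) auto
  have w0_le: "pmf w0 \<sigma> \<le> \<gamma> * pmf \<omega> \<sigma>" for \<sigma>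
    using \<gamma>_ge[of \<sigma>] pos[of \<sigma>] by (simp add: pos_divide_le_eq)
  obtain \<sigma>0 where \<sigma>0: "\<sigma>0 \<in> set_pmf w0" using set_pmf_not_empty[of w0] by blast
  have "0 < pmf w0 \<sigma>0 / pmf \<omega> \<sigma>0" using pos[of \<sigma>0] \<sigma>0 by (simp add: pmf_positive)
  then have \<gamma>: "0 < \<gamma>" using \<gamma>_ge[of \<sigma>0] by linarith
  define Z where "Z = (\<Sum>R\<in>Iinit. muR R)"
  \<comment> \<open>The term of the empty set gives \<open>1 \<le> Z\<close>, so \<open>ln Z\<close>
    is a genuine logarithm.\<close>
  have "{} \<in> Iinit" using J(2)[OF \<sigma>0] by (auto simp: Ind_def)
  then have "muR {} \<le> Z" unfolding Z_def using J(1) mu(2) by (intro member_le_sum) auto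
  then have Z: "0 < Z" using mu(1) by simp

  \<comment> \<open>For an integer number of steps, fewer than \<open>T + r\<close> means below this
    ceiling; a negative ceiling is cut to 0.\<close>
  define t where "t = nat \<lceil>T + r\<rceil>"
  have "emeasure (run F rho w0 S t) {h. length (snd h) = t} \<le> ennreal (\<gamma> * \<theta> ^ t * Z)"
    using alt
  proof (elim disjE conjE)
    assume S: "S = stable_strategy F sim \<pi>"
    interpret flaw_kernel F sim \<pi> rho \<omega> lam "step_kernel F rho"
      using ok pos by (rule step_flaw_kernel)
    have "emeasure (run F rho w0 S t) {h. length (snd h) = t}
        \<le> (\<integral>\<^sup>+\<sigma>. ennreal (\<Sum>w\<in>layered_words t. G w \<sigma>) \<partial>w0)"
      using strat stable_run_layered unfolding S by (rule run_le_layered_if_layered)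
    also have "\<dots> \<le> ennreal (\<gamma> * \<theta> ^ t * Z)"
      unfolding Z_def using theta \<gamma> by (intro layered_bound mu w0_le J) auto
    finally show ?thesis .
  next
    assume wc: "weakly_commutative F sim rho" and atomic: "atomic F rho"
    interpret flaw_kernel F sim \<pi> rho \<omega> lam "ratio_kernel F rho \<omega> lam"
      using ok pos atomic by (rule ratio_flaw_kernel)
    have "emeasure (run F rho w0 S t) {h. length (snd h) = t}
        \<le> (\<integral>\<^sup>+\<sigma>. ennreal (\<Sum>w\<in>layered_words t. G w \<sigma>) \<partial>w0)"
      using sim_sym lam_nonneg
      by (intro run_le_layered_if_commute strat ratio_kernel_commute[OF wc _ _ pos]) (auto simp: comm_def)
    also have "\<dots> \<le> ennreal (\<gamma> * \<theta> ^ t * Z)"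
      unfolding Z_def using theta \<gamma> by (intro layered_bound mu w0_le J) auto
    finally show ?thesis .
  next
    assume sc: "strongly_commutative F sim rho"
    interpret flaw_kernel F sim \<pi> rho \<omega> lam "step_kernel F rho"
      using ok pos by (rule step_flaw_kernel)
    have "emeasure (run F rho w0 S t) {h. length (snd h) = t}
        \<le> (\<integral>\<^sup>+\<sigma>. ennreal (\<Sum>w\<in>layered_words t. G w \<sigma>) \<partial>w0)"
      using sim_sym
      by (intro run_le_layered_if_commute strat step_kernel_commute[OF sc]) (auto simp: comm_def)
    also have "\<dots> \<le> ennreal (\<gamma> * \<theta> ^ t * Z)"
      unfolding Z_def using theta \<gamma> by (intro layered_bound mu w0_le J) auto
    finally show ?thesis .
  qed
  then have long: "measure_pmf.prob (run F rho w0 S t) {h. length (snd h) = t} \<le> \<gamma> * \<theta> ^ t * Z"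
    using \<gamma> Z theta by (simp add: measure_pmf.emeasure_eq_measure)

  have tn: "t \<le> n" and Tt: "T + r \<le> real t" using n by (auto simp: t_def nat_le_iff ceiling_le_iff real_nat_ceiling_ge)
  \<comment> \<open>\<open>T\<close> is chosen to turn the prefactor into a power of
    \<open>\<theta>\<close>, leaving the exponent \<open>real t - T \<ge> r\<close>.\<close>
  have \<gamma>Z: "\<gamma> * Z = \<theta> powr (- T)"
  proof -
    have "ln (\<gamma> * Z) = T * ln (1 / \<theta>)"
      using T theta \<gamma> Z by (simp add: ln_mult ln_div \<gamma>_def Z_def)
    also have "\<dots> = - T * ln \<theta>" using theta by (simp add: ln_div)
    finally have "exp (ln (\<gamma> * Z)) = exp (- T * ln \<theta>)" by simp
    then show ?thesis using \<gamma> Z theta by (simp add: powr_def)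
  qed
  have "\<gamma> * \<theta> ^ t * Z = \<theta> powr (- T) * \<theta> powr real t"
    unfolding \<gamma>Z[symmetric] using theta by (simp add: powr_realpow mult_ac)
  also have "\<dots> = \<theta> powr (real t - T)" by (simp flip: powr_add)
  also have "\<dots> \<le> \<theta> powr r" using theta Tt by (intro powr_mono') auto
  finally have "measure_pmf.prob (run F rho w0 S n) {h. t \<le> length (snd h)} \<le> \<theta> powr r"
    using long run_prob_long_antimono[OF tn, of F rho w0 S] by linarith
  moreover have "measure_pmf.prob (run F rho w0 S n) {h. t \<le> length (snd h)}
      = 1 - measure_pmf.prob (run F rho w0 S n) {h. length (snd h) < t}"
    by (subst measure_pmf.prob_compl[symmetric]) (auto intro!: arg_cong[where f = "measure_pmf.prob _"])
  moreover have "measure_pmf.prob (run F rho w0 S n) {h. length (snd h) < t}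
      \<le> measure_pmf.prob (run F rho w0 S n) {h. flaws_at F (cur h) = {} \<and> real (length (snd h)) < T + r}"
  \<comment> \<open>A run with fewer than \<open>t \<le> n\<close> steps has stopped within the
    \<open>n\<close> rounds, so its last object is flawless.\<close>
  proof (intro measure_pmf.finite_measure_mono_AE, unfold AE_measure_pmf_iff, intro ballI impI)
    fix h assume h: "h \<in> set_pmf (run F rho w0 S n)" and "h \<in> {h. length (snd h) < t}"
    then have len: "length (snd h) < t" by simp
    then have "int (length (snd h)) < \<lceil>T + r\<rceil>" by (simp add: t_def)
    then have "real (length (snd h)) < T + r" by (simp add: less_ceiling_iff)
    then show "h \<in> {h. flaws_at F (cur h) = {} \<and> real (length (snd h)) < T + r}"
      using run_length[OF h] len tn by auto
  qed simp
  ultimately show ?thesis by linarith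
qed

end
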